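(* Consider the integro-differential equation $$F(x,u,\nabla u,\nabla^2 u)-\int_{\mathbf{R}^N}\bigl[u(x+z)-u(x)-\mathbf 1_{|z|\le 1}\langle \nabla u(x),z\rangle\bigr]q(z)\,dz=0,\qquad x\in\Omega, \qquad (E)$$ with $\Omega$, $F$, $q$ as specified in the context, and the notions of viscosity subsolution and supersolution of (E) in the sense of Definitions A, B and C given in the context. Then: (i) If $u$ is a viscosity subsolution (resp. supersolution) of (E) in the sense of Definition A, then $u$ is a viscosity subsolution (resp. supersolution) of (E) in the sense of Definition B. (ii) If $u$ is a viscosity subsolution (resp. supersolution) of (E) in the sense of Definition C, then $u$ is a viscosity subsolution (resp. supersolution) of (E) in the sense of Definition A.
   Context: Setting: $\Omega\subset\mathbf{R}^N$; $\mathbf{S}^N$ is the space of real symmetric $N\times N$ matrices; $F\in C(\Omega\times\mathbf{R}\times\mathbf{R}^N\times\mathbf{S}^N)$ is a second-order fully nonlinear elliptic operator (ellipticity in the usual sense of viscosity solution theory: $F(x,r,p,X)\ge F(x,r,p,Y)$ whenever $X\le Y$). The Lévy measure $q(z)\,dz$ is a positive Radon measure with $\int_{|z|<1}|z|^2q(z)\,dz+\int_{|z|\ge 1}q(z)\,dz<\infty$. $\mathbf 1_{|z|\le 1}$ is the indicator function of $\{|z|\le 1\}$, and $I$ is the identity matrix. $USC(\mathbf{R}^N)$ and $LSC(\mathbf{R}^N)$ denote the upper and lower semicontinuous functions on $\mathbf{R}^N$. For $u\in USC(\mathbf{R}^N)$, $J^{2,+}_{\mathbf{R}^N}u(x)$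 is the set of $(p,X)\in\mathbf{R}^N\times\mathbf{S}^N$ such that for any $\delta>0$ there exists $\varepsilon>0$ with $$u(x+z)-u(x)\le\langle p,z\rangle+\tfrac12\langle Xz,z\rangle+\delta|z|^2\quad\forall |z|\le\varepsilon. \qquad (1)$$ For $v\in LSC(\mathbf{R}^N)$, $J^{2,-}_{\mathbf{R}^N}v(x)$ is the set of $(p,X)\in\mathbf{R}^N\times\mathbf{S}^N$ such that for any $\delta>0$ there exists $\varepsilon>0$ with $$v(x+z)-v(x)\ge\langle p,z\rangle+\tfrac12\langle Xz,z\rangle-\delta|z|^2\quad\forall |z|\le\varepsilon. \qquad (2)$$ Definition A. $u\in USC(\mathbf{R}^N)$ (resp. $v\in LSC(\mathbf{R}^N)$) is a viscosity subsolution (resp. supersolution) of (E) if for any $\hat x\in\Omega$, any $(p,X)\in J^{2,+}_{\mathbf{R}^N}u(\hat x)$ (resp. $\in J^{2,-}_{\mathbf{R}^N}v(\hat x)$), and any pair of positive numbers $(\varepsilon,\delta)$ satisfying (1) (resp. (2)) at $x=\hat x$, $$F(\hat x,u(\hat x),p,X)-\int_{|z|<\varepsilon}\tfrac12\langle(X+2\delta I)z,z\rangle q(z)\,dz-\int_{|z|\ge\varepsilon}[u(\hat x+z)-u(\hat x)-\mathbf 1_{|z|\le1}\langle z,p\rangle]q(z)\,dz\le0$$ (resp. $$F(\hat x,v(\hat x),p,X)-\int_{|z|<\varepsilon}\tfrac12\langle(X-2\delta I)z,z\rangle q(z)\,dz-\int_{|z|\ge\varepsilon}[v(\hat x+z)-v(\hat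 x)-\mathbf 1_{|z|\le1}\langle z,p\rangle]q(z)\,dz\ge0).$$ Definition B. $u\in USC(\mathbf{R}^N)$ (resp. $v\in LSC(\mathbf{R}^N)$) is a viscosity subsolution (resp. supersolution) of (E) if for any $\hat x\in\Omega$ and any $\phi\in C^2(\mathbf{R}^N)$ such that $u(\hat x)=\phi(\hat x)$ and $u-\phi$ takes a global maximum at $\hat x$ (resp. $v(\hat x)=\phi(\hat x)$ and $v-\phi$ takes a global minimum at $\hat x$), $$F(\hat x,u(\hat x),\nabla\phi(\hat x),\nabla^2\phi(\hat x))-\int_{\mathbf{R}^N}[\phi(\hat x+z)-\phi(\hat x)-\mathbf 1_{|z|\le1}\langle z,\nabla\phi(\hat x)\rangle]q(z)\,dz\le 0$$ (resp. $$F(\hat x,v(\hat x),\nabla\phi(\hat x),\nabla^2\phi(\hat x))-\int_{\mathbf{R}^N}[\phi(\hat x+z)-\phi(\hat x)-\mathbf 1_{|z|\le1}\langle z,\nabla\phi(\hat x)\rangle]q(z)\,dz\ge 0).$$ Definition C. $u\in USC(\mathbf{R}^N)$ (resp. $v\in LSC(\mathbf{R}^N)$) is a viscosity subsolution (resp. supersolution) of (E) if for any $\hat x\in\Omega$ and any $\phi\in C^2(\mathbf{R}^N)$ such that $u(\hat x)=\phi(\hat x)$ and $u-\phi$ takes a global maximum at $\hat x$ (resp. $v(\hat x)=\phi(\hat x)$ and $v-\phi$ takes a global minimum at $\hat x$), the function $h(z)=u(\hat x+z)-u(\hat x)-\mathbf 1_{|z|\le1}\langle z,\nabla\phi(\hat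 x)\rangle$ (resp. the same with $v$ in place of $u$) belongs to $L^1(\mathbf{R}^N,q(z)dz)$ and $$F(\hat x,u(\hat x),\nabla\phi(\hat x),\nabla^2\phi(\hat x))-\int_{\mathbf{R}^N}[u(\hat x+z)-u(\hat x)-\mathbf 1_{|z|\le1}\langle z,\nabla\phi(\hat x)\rangle]q(z)\,dz\le 0$$ (resp. $$F(\hat x,v(\hat x),\nabla\phi(\hat x),\nabla^2\phi(\hat x))-\int_{\mathbf{R}^N}[v(\hat x+z)-v(\hat x)-\mathbf 1_{|z|\le1}\langle z,\nabla\phi(\hat x)\rangle]q(z)\,dz\ge 0).$$
   Formalization: In Definition A the pairs (ε,δ) are restricted to ε ≤ 1; with ε > 1 part (ii) fails (N=1, u(x)=x, q = Lebesgue measure on [1,2], F = 3/2, ε = 3, δ small). Integrals that may be infinite are read as extended Lebesgue integrals required to exist. *)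

theory Defs
  imports "HOL-Analysis.Analysis"
begin

definition usc :: "('a::topological_space \<Rightarrow> real) \<Rightarrow> bool" where
  "usc u \<longleftrightarrow> (\<forall>c. open {x. u x < c})"

definition lsc :: "('a::topological_space \<Rightarrow> real) \<Rightarrow> bool" where
  "lsc u \<longleftrightarrow> (\<forall>c. open {x. c < u x})"

definition sym_mat :: "real^'n^'n \<Rightarrow> bool" where
  "sym_mat X \<longleftrightarrow> transpose X = X"

definition loewner_le :: "real^'n^'n \<Rightarrow> real^'n^'n \<Rightarrow> bool" where
  "loewner_le X Y \<longleftrightarrow> (\<forall>z. (X *v z) \<bullet> z \<le> (Y *v z) \<bullet> z)"

definition continuous_operator ::
  "(real^'n) set \<Rightarrow> (real^'n \<Rightarrow> real \<Rightarrow> real^'n \<Rightarrow> real^'n^'n \<Rightarrow> real) \<Rightarrow> bool" where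
  "continuous_operator \<Omega> F \<longleftrightarrow>
     continuous_on (\<Omega> \<times> UNIV \<times> UNIV \<times> {X. sym_mat X}) (\<lambda>(x, r, p, X). F x r p X)"

definition elliptic ::
  "(real^'n) set \<Rightarrow> (real^'n \<Rightarrow> real \<Rightarrow> real^'n \<Rightarrow> real^'n^'n \<Rightarrow> real) \<Rightarrow> bool" where
  "elliptic \<Omega> F \<longleftrightarrow>
     (\<forall>x\<in>\<Omega>. \<forall>r p X Y. sym_mat X \<longrightarrow> sym_mat Y \<longrightarrow> loewner_le X Y \<longrightarrow> F x r p Y \<le> F x r p X)"

(* The measure written q(z) dz is the single object q; a density g corresponds to
   density lborel g.  The total mass near 0 may be infinite.  Local finiteness away from 0,
   hence the Radon property on the complement of 0, follows from the integral bound. *)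
definition levy_measure :: "(real^'n) measure \<Rightarrow> bool" where
  "levy_measure q \<longleftrightarrow> sets q = sets borel \<and>
     (\<integral>\<^sup>+z\<in>ball 0 1. ennreal ((norm z)\<^sup>2) \<partial>q) + (\<integral>\<^sup>+z\<in>- ball 0 1. 1 \<partial>q) < \<infinity>"

(* Integrals of functions that need not be absolutely integrable (u and the test functions are
   not assumed bounded) are Lebesgue integrals with values in [-infinity, infinity].  The value
   of ext_integral is meaningful only under ext_integral_exists: measurability, and at least one
   of the positive and negative parts has finite integral. *)
definition ext_integral :: "'a measure \<Rightarrow> 'a set \<Rightarrow> ('a \<Rightarrow> real) \<Rightarrow> ereal" where
  "ext_integral M A f =
     enn2ereal (\<integral>\<^sup>+z\<in>A. ennreal (f z) \<partial>M) - enn2ereal (\<integral>\<^sup>+z\<in>A. ennreal (- f z) \<partial>M)"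

definition ext_integral_exists :: "'a measure \<Rightarrow> 'a set \<Rightarrow> ('a \<Rightarrow> real) \<Rightarrow> bool" where
  "ext_integral_exists M A f \<longleftrightarrow> set_borel_measurable M A f \<and>
     ((\<integral>\<^sup>+z\<in>A. ennreal (f z) \<partial>M) < \<infinity> \<or> (\<integral>\<^sup>+z\<in>A. ennreal (- f z) \<partial>M) < \<infinity>)"

(* The integrand w(x+z) - w(x) - 1_{|z|<=1} <z,p> of the nonlocal term. *)
definition levy_integrand :: "(real^'n \<Rightarrow> real) \<Rightarrow> real^'n \<Rightarrow> real^'n \<Rightarrow> real^'n \<Rightarrow> real" where
  "levy_integrand w x p z = w (x + z) - w x - indicator (cball 0 1) z * (z \<bullet> p)"

definition touch_above ::
  "(real^'n \<Rightarrow> real) \<Rightarrow> real^'n \<Rightarrow> real^'n \<Rightarrow> real^'n^'n \<Rightarrow> real \<Rightarrow> real \<Rightarrow> bool" where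
  "touch_above u x p X \<epsilon> \<delta> \<longleftrightarrow>
     (\<forall>z. norm z \<le> \<epsilon> \<longrightarrow> u (x + z) - u x \<le> p \<bullet> z + 1/2 * ((X *v z) \<bullet> z) + \<delta> * (norm z)\<^sup>2)"

definition touch_below ::
  "(real^'n \<Rightarrow> real) \<Rightarrow> real^'n \<Rightarrow> real^'n \<Rightarrow> real^'n^'n \<Rightarrow> real \<Rightarrow> real \<Rightarrow> bool" where
  "touch_below v x p X \<epsilon> \<delta> \<longleftrightarrow>
     (\<forall>z. norm z \<le> \<epsilon> \<longrightarrow> v (x + z) - v x \<ge> p \<bullet> z + 1/2 * ((X *v z) \<bullet> z) - \<delta> * (norm z)\<^sup>2)"

definition superjet :: "(real^'n \<Rightarrow> real) \<Rightarrow> real^'n \<Rightarrow> ((real^'n) \<times> (real^'n^'n)) set" where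
  "superjet u x = {(p, X). sym_mat X \<and> (\<forall>\<delta>>0. \<exists>\<epsilon>>0. touch_above u x p X \<epsilon> \<delta>)}"

definition subjet :: "(real^'n \<Rightarrow> real) \<Rightarrow> real^'n \<Rightarrow> ((real^'n) \<times> (real^'n^'n)) set" where
  "subjet v x = {(p, X). sym_mat X \<and> (\<forall>\<delta>>0. \<exists>\<epsilon>>0. touch_below v x p X \<epsilon> \<delta>)}"

definition grad :: "(real^'n \<Rightarrow> real) \<Rightarrow> real^'n \<Rightarrow> real^'n" where
  "grad \<phi> x = (THE D. GDERIV \<phi> x :> D)"

definition hess :: "(real^'n \<Rightarrow> real) \<Rightarrow> real^'n \<Rightarrow> real^'n^'n" where
  "hess \<phi> x = matrix (frechet_derivative (grad \<phi>) (at x))"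

definition C2 :: "(real^'n \<Rightarrow> real) \<Rightarrow> bool" where
  "C2 \<phi> \<longleftrightarrow> (\<forall>x. \<phi> differentiable at x) \<and> (\<forall>x. grad \<phi> differentiable at x) \<and>
     continuous_on UNIV (hess \<phi>)"

definition test_above :: "(real^'n \<Rightarrow> real) \<Rightarrow> (real^'n \<Rightarrow> real) \<Rightarrow> real^'n \<Rightarrow> bool" where
  "test_above u \<phi> x \<longleftrightarrow> C2 \<phi> \<and> u x = \<phi> x \<and> (\<forall>y. u y - \<phi> y \<le> u x - \<phi> x)"

definition test_below :: "(real^'n \<Rightarrow> real) \<Rightarrow> (real^'n \<Rightarrow> real) \<Rightarrow> real^'n \<Rightarrow> bool" where
  "test_below v \<phi> x \<longleftrightarrow> C2 \<phi> \<and> v x = \<phi> x \<and> (\<forall>y. v x - \<phi> x \<le> v y - \<phi> y)"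

(* In the jet formulation (A) the radius ranges over 0 < epsilon <= 1: the first integrand has
   no gradient term because 1_{|z|<=1} <z,p> has cancelled the linear part of the jet expansion,
   and this cancellation takes place only for |z| <= 1.  With radii larger than 1 the formula would
   drop the integral of <z,p> over 1 < |z| < epsilon, and a classical solution could violate (A):
   take N = 1, u(x) = x, q = Lebesgue measure on [1,2], F = 3/2, epsilon = 3 and delta small.

   An inequality that involves an extended integral includes the requirement that the
   integral exists. *)
definition subsolution_A ::
  "(real^'n) set \<Rightarrow> (real^'n \<Rightarrow> real \<Rightarrow> real^'n \<Rightarrow> real^'n^'n \<Rightarrow> real) \<Rightarrow> (real^'n) measure \<Rightarrow>
   (real^'n \<Rightarrow> real) \<Rightarrow> bool" where
  "subsolution_A \<Omega> F q u \<longleftrightarrow> usc u \<and>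
     (\<forall>x\<in>\<Omega>. \<forall>(p, X)\<in>superjet u x. \<forall>\<epsilon> \<delta>. 0 < \<epsilon> \<longrightarrow> \<epsilon> \<le> 1 \<longrightarrow> 0 < \<delta> \<longrightarrow> touch_above u x p X \<epsilon> \<delta> \<longrightarrow>
        ext_integral_exists q (- ball 0 \<epsilon>) (levy_integrand u x p) \<and>
        ereal (F x (u x) p X)
          - ereal (LINT z:ball 0 \<epsilon>|q. 1/2 * (((X + (2 * \<delta>) *\<^sub>R mat 1) *v z) \<bullet> z))
          - ext_integral q (- ball 0 \<epsilon>) (levy_integrand u x p) \<le> 0)"

definition supersolution_A ::
  "(real^'n) set \<Rightarrow> (real^'n \<Rightarrow> real \<Rightarrow> real^'n \<Rightarrow> real^'n^'n \<Rightarrow> real) \<Rightarrow> (real^'n) measure \<Rightarrow>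
   (real^'n \<Rightarrow> real) \<Rightarrow> bool" where
  "supersolution_A \<Omega> F q v \<longleftrightarrow> lsc v \<and>
     (\<forall>x\<in>\<Omega>. \<forall>(p, X)\<in>subjet v x. \<forall>\<epsilon> \<delta>. 0 < \<epsilon> \<longrightarrow> \<epsilon> \<le> 1 \<longrightarrow> 0 < \<delta> \<longrightarrow> touch_below v x p X \<epsilon> \<delta> \<longrightarrow>
        ext_integral_exists q (- ball 0 \<epsilon>) (levy_integrand v x p) \<and>
        ereal (F x (v x) p X)
          - ereal (LINT z:ball 0 \<epsilon>|q. 1/2 * (((X - (2 * \<delta>) *\<^sub>R mat 1) *v z) \<bullet> z))
          - ext_integral q (- ball 0 \<epsilon>) (levy_integrand v x p) \<ge> 0)"

definition subsolution_B ::
  "(real^'n) set \<Rightarrow> (real^'n \<Rightarrow> real \<Rightarrow> real^'n \<Rightarrow> real^'n^'n \<Rightarrow> real) \<Rightarrow> (real^'n) measure \<Rightarrow>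
   (real^'n \<Rightarrow> real) \<Rightarrow> bool" where
  "subsolution_B \<Omega> F q u \<longleftrightarrow> usc u \<and>
     (\<forall>x\<in>\<Omega>. \<forall>\<phi>. test_above u \<phi> x \<longrightarrow>
        ext_integral_exists q UNIV (levy_integrand \<phi> x (grad \<phi> x)) \<and>
        ereal (F x (u x) (grad \<phi> x) (hess \<phi> x))
          - ext_integral q UNIV (levy_integrand \<phi> x (grad \<phi> x)) \<le> 0)"

definition supersolution_B ::
  "(real^'n) set \<Rightarrow> (real^'n \<Rightarrow> real \<Rightarrow> real^'n \<Rightarrow> real^'n^'n \<Rightarrow> real) \<Rightarrow> (real^'n) measure \<Rightarrow>
   (real^'n \<Rightarrow> real) \<Rightarrow> bool" where
  "supersolution_B \<Omega> F q v \<longleftrightarrow> lsc v \<and>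
     (\<forall>x\<in>\<Omega>. \<forall>\<phi>. test_below v \<phi> x \<longrightarrow>
        ext_integral_exists q UNIV (levy_integrand \<phi> x (grad \<phi> x)) \<and>
        ereal (F x (v x) (grad \<phi> x) (hess \<phi> x))
          - ext_integral q UNIV (levy_integrand \<phi> x (grad \<phi> x)) \<ge> 0)"

definition subsolution_C ::
  "(real^'n) set \<Rightarrow> (real^'n \<Rightarrow> real \<Rightarrow> real^'n \<Rightarrow> real^'n^'n \<Rightarrow> real) \<Rightarrow> (real^'n) measure \<Rightarrow>
   (real^'n \<Rightarrow> real) \<Rightarrow> bool" where
  "subsolution_C \<Omega> F q u \<longleftrightarrow> usc u \<and>
     (\<forall>x\<in>\<Omega>. \<forall>\<phi>. test_above u \<phi> x \<longrightarrow>
        integrable q (levy_integrand u x (grad \<phi> x)) \<and>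
        F x (u x) (grad \<phi> x) (hess \<phi> x) - (LINT z|q. levy_integrand u x (grad \<phi> x) z) \<le> 0)"

definition supersolution_C ::
  "(real^'n) set \<Rightarrow> (real^'n \<Rightarrow> real \<Rightarrow> real^'n \<Rightarrow> real^'n^'n \<Rightarrow> real) \<Rightarrow> (real^'n) measure \<Rightarrow>
   (real^'n \<Rightarrow> real) \<Rightarrow> bool" where
  "supersolution_C \<Omega> F q v \<longleftrightarrow> lsc v \<and>
     (\<forall>x\<in>\<Omega>. \<forall>\<phi>. test_below v \<phi> x \<longrightarrow>
        integrable q (levy_integrand v x (grad \<phi> x)) \<and>
        F x (v x) (grad \<phi> x) (hess \<phi> x) - (LINT z|q. levy_integrand v x (grad \<phi> x) z) \<ge> 0)"

end

theory Submission
  imports Defs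
begin

text \<open>
  The supersolution statements follow from the subsolution statements by replacing \<open>v\<close> with \<open>- v\<close>
  and \<open>F\<close> with \<open>(x, r, p, X) \<mapsto> - F x (- r) (- p) (- X)\<close>, which exchanges upper and lower touching
  and changes the sign of every integral. Only subsolutions need a direct argument.

  From jets to test functions (\<open>subsolution_A_imp_B\<close>): let the \<open>C\<^sup>2\<close> function \<open>\<phi>\<close> touch \<open>u\<close> from
  above at \<open>x\<close>, and put \<open>p = grad \<phi> x\<close>, \<open>X = hess \<phi> x\<close>. By Taylor's formula and the symmetry of
  the Hessian, \<open>(p, X)\<close> lies in the superjet of \<open>u\<close>, and for every \<open>\<delta> > 0\<close> there is a radius
  \<open>\<epsilon> \<le> 1\<close> that is admissible for \<open>\<delta>\<close>. On \<open>|z| < \<epsilon>\<close> the form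
  \<open>1/2 \<langle>(X + 2\<delta>I) z, z\<rangle>\<close> exceeds the integrand of \<open>\<phi>\<close> by at most \<open>2\<delta>|z|\<^sup>2\<close>, and on \<open>|z| \<ge> \<epsilon>\<close> the
  integrand of \<open>u\<close> is at most that of \<open>\<phi>\<close>. So the jet inequality gives the inequality for \<open>\<phi>\<close> up
  to an error \<open>2\<delta> \<integral>\<^bsub>|z|<1\<^esub> |z|\<^sup>2 q\<close>, which tends to 0 with \<open>\<delta>\<close>. It also
  shows that the negative part of the integrand of \<open>u\<close>, hence that of \<open>\<phi>\<close>, has a finite integral, so
  that the integral of \<open>\<phi>\<close> over the whole space exists.

  From test functions to jets (\<open>subsolution_C_imp_A\<close>): let \<open>(p, X)\<close> be in the superjet of \<open>u\<close> at
  \<open>x\<close>. For each \<open>d > 0\<close> there is a \<open>C\<^sup>2\<close> function that touches \<open>u\<close> globally from above at \<open>x\<close>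
  with gradient \<open>p\<close> and Hessian \<open>X + 2dI\<close> (\<open>touch_above_imp_test_above\<close>): a quadratic polynomial
  dominates \<open>u\<close> near \<open>x\<close>, and a radial function that vanishes near \<open>x\<close> and grows fast enough
  makes up for the rest, because \<open>u\<close> is bounded above on compact sets. The integral in the third
  notion of solution involves only \<open>u\<close> and \<open>p\<close>, so letting \<open>d\<close> tend to 0 and using continuity of
  \<open>F\<close> gives \<open>F x (u x) p X \<le> \<integral> [u (x + z) - u x - \<dots>] q\<close>. On \<open>|z| < \<epsilon>\<close> the integrand is then
  bounded by the quadratic form of the touching condition.
\<close>

section \<open>Calculus of twice differentiable functions\<close>

lemma GDERIV_imp_grad:
  fixes \<phi> :: "real^'n \<Rightarrow> real"
  assumes "GDERIV \<phi> x :> D"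
  shows "grad \<phi> x = D"
  unfolding grad_def
proof (rule the_equality)
  show "GDERIV \<phi> x :> D" by fact
next
  fix D' assume "GDERIV \<phi> x :> D'"
  from has_derivative_unique[OF this[unfolded gderiv_def] assms[unfolded gderiv_def]]
  have "(\<lambda>h. h \<bullet> D') = (\<lambda>h. h \<bullet> D)" .
  then have "\<forall>h. h \<bullet> D' = h \<bullet> D" by (auto dest: fun_cong)
  then show "D' = D" by (simp only: vector_eq_ldot)
qed

lemma GDERIV_grad:
  fixes \<phi> :: "real^'n \<Rightarrow> real"
  assumes "\<phi> differentiable at x"
  shows "GDERIV \<phi> x :> grad \<phi> x"
proof -
  let ?f' = "frechet_derivative \<phi> (at x)"
  have der: "(\<phi> has_derivative ?f') (at x)"
    using assms frechet_derivative_works by blast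
  have lin: "linear ?f'" using der has_derivative_linear by blast
  have "?f' h = h \<bullet> adjoint ?f' 1" for h
    using adjoint_works[OF lin, of h 1] by simp
  then have "?f' = (\<lambda>h. h \<bullet> adjoint ?f' 1)" by blast
  with der have "GDERIV \<phi> x :> adjoint ?f' 1"
    unfolding gderiv_def by metis
  then show ?thesis using GDERIV_imp_grad by metis
qed

lemma has_derivative_imp_hess:
  fixes \<phi> :: "real^'n \<Rightarrow> real"
  assumes "(grad \<phi> has_derivative (\<lambda>h. H *v h)) (at x)"
  shows "hess \<phi> x = H"
  unfolding hess_def using frechet_derivative_at[OF assms] by (metis matrix_of_matrix_vector_mul)

lemma has_derivative_hess:
  fixes \<phi> :: "real^'n \<Rightarrow> real"
  assumes "grad \<phi> differentiable at x"
  shows "(grad \<phi> has_derivative (\<lambda>h. hess \<phi> x *v h)) (at x)"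
  using assms unfolding hess_def jacobian_works by (simp add: jacobian_def)

lemma C2_intro:
  fixes \<phi> :: "real^'n \<Rightarrow> real"
  assumes G: "\<And>x. GDERIV \<phi> x :> G x"
    and H: "\<And>x. (G has_derivative (\<lambda>h. H x *v h)) (at x)"
    and cont: "continuous_on UNIV H"
  shows "C2 \<phi>" "grad \<phi> = G" "hess \<phi> = H"
proof -
  show g: "grad \<phi> = G" using G GDERIV_imp_grad by blast
  show h: "hess \<phi> = H" using H has_derivative_imp_hess unfolding g[symmetric] by blast
  show "C2 \<phi>"
    unfolding C2_def g h using G H cont by (auto simp: gderiv_def differentiable_def)
qed

lemma
  fixes \<phi> :: "real^'n \<Rightarrow> real"
  assumes "C2 \<phi>"
  shows C2_GDERIV: "GDERIV \<phi> x :> grad \<phi> x"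
    and C2_has_derivative_grad: "(grad \<phi> has_derivative (\<lambda>h. hess \<phi> x *v h)) (at x)"
    and C2_continuous: "continuous_on UNIV \<phi>"
proof -
  show "GDERIV \<phi> x :> grad \<phi> x"
    using assms GDERIV_grad unfolding C2_def by blast
  show "(grad \<phi> has_derivative (\<lambda>h. hess \<phi> x *v h)) (at x)"
    using assms has_derivative_hess unfolding C2_def by blast
  show "continuous_on UNIV \<phi>"
    using assms unfolding C2_def
    by (simp add: continuous_at_imp_continuous_on differentiable_imp_continuous_within)
qed

lemma minus_matrix_vector_mult: "(- A) *v z = - (A *v z)"
  for A :: "'a::ring_1^'n^'m"
  by (simp add: vec_eq_iff matrix_vector_mult_def sum_negf)

lemma C2_uminus:
  fixes \<phi> :: "real^'n \<Rightarrow> real"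
  assumes "C2 \<phi>"
  shows "C2 (\<lambda>x. - \<phi> x)" "grad (\<lambda>x. - \<phi> x) = (\<lambda>x. - grad \<phi> x)"
    "hess (\<lambda>x. - \<phi> x) = (\<lambda>x. - hess \<phi> x)"
proof -
  have 1: "GDERIV (\<lambda>x. - \<phi> x) x :> - grad \<phi> x" for x
    using C2_GDERIV[OF assms] by (rule GDERIV_minus)
  have 2: "((\<lambda>x. - grad \<phi> x) has_derivative (\<lambda>h. (- hess \<phi> x) *v h)) (at x)" for x
    using has_derivative_minus[OF C2_has_derivative_grad[OF assms, of x]]
    by (simp add: minus_matrix_vector_mult)
  have 3: "continuous_on UNIV (\<lambda>x. - hess \<phi> x)"
    using assms unfolding C2_def by (intro continuous_intros) simp
  show "C2 (\<lambda>x. - \<phi> x)" "grad (\<lambda>x. - \<phi> x) = (\<lambda>x. - grad \<phi> x)"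
    "hess (\<lambda>x. - \<phi> x) = (\<lambda>x. - hess \<phi> x)"
    using C2_intro[where \<phi> = "\<lambda>x. - \<phi> x" and G = "\<lambda>x. - grad \<phi> x" and H = "\<lambda>x. - hess \<phi> x", OF 1 2 3]
    by blast+
qed

lemma C2_GDERIV_line:
  fixes \<phi> :: "real^'n \<Rightarrow> real"
  assumes "C2 \<phi>"
  shows "((\<lambda>t. \<phi> (a + t *\<^sub>R h)) has_field_derivative (grad \<phi> (a + t *\<^sub>R h) \<bullet> h)) (at t)"
proof -
  have line: "((\<lambda>t. a + t *\<^sub>R h) has_derivative (\<lambda>s. 0 + s *\<^sub>R h)) (at t)"
    by (intro has_derivative_add has_derivative_const has_derivative_scaleR_left has_derivative_ident)
  have \<phi>: "(\<phi> has_derivative (\<lambda>k. k \<bullet> grad \<phi> (a + t *\<^sub>R h))) (at (a + t *\<^sub>R h))"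
    using C2_GDERIV[OF assms] unfolding gderiv_def .
  have comp: "((\<lambda>t. \<phi> (a + t *\<^sub>R h)) has_derivative
      (\<lambda>s. (0 + s *\<^sub>R h) \<bullet> grad \<phi> (a + t *\<^sub>R h))) (at t)"
    by (rule has_derivative_compose[OF line \<phi>])
  have eq: "(\<lambda>s. (0 + s *\<^sub>R h) \<bullet> grad \<phi> (a + t *\<^sub>R h)) = (*) (grad \<phi> (a + t *\<^sub>R h) \<bullet> h)"
    by (rule ext) (simp add: inner_commute)
  show ?thesis unfolding has_field_derivative_def by (rule has_derivative_eq_rhs[OF comp eq])
qed

lemma C2_grad_approx:
  fixes \<phi> :: "real^'n \<Rightarrow> real"
  assumes "C2 \<phi>" "0 < \<delta>"
  shows "\<exists>\<epsilon>>0. \<forall>w. norm w \<le> \<epsilon> \<longrightarrow>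
    norm (grad \<phi> (x + w) - grad \<phi> x - hess \<phi> x *v w) \<le> \<delta> * norm w"
proof -
  have "\<exists>d>0. \<forall>y. norm (y - x) < d \<longrightarrow>
      norm (grad \<phi> y - grad \<phi> x - hess \<phi> x *v (y - x)) \<le> \<delta> * norm (y - x)"
    using C2_has_derivative_grad[OF assms(1), of x] \<open>0 < \<delta>\<close>
    by (simp add: has_derivative_at_alt)
  then obtain d where d: "d > 0" "\<And>y. norm (y - x) < d \<Longrightarrow>
      norm (grad \<phi> y - grad \<phi> x - hess \<phi> x *v (y - x)) \<le> \<delta> * norm (y - x)"
    by auto
  have "norm (grad \<phi> (x + w) - grad \<phi> x - hess \<phi> x *v w) \<le> \<delta> * norm w" if "norm w \<le> d/2" for w
    using d(2)[of "x + w"] that \<open>d > 0\<close> by simp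
  with half_gt_zero[OF \<open>d > 0\<close>] show ?thesis by (intro exI[of _ "d/2"]) simp
qed

text \<open>Second-order Taylor expansion with a Peano remainder; it only uses differentiability of the
  gradient at the base point.\<close>
lemma C2_taylor:
  fixes \<phi> :: "real^'n \<Rightarrow> real"
  assumes "C2 \<phi>" "0 < \<delta>"
  shows "\<exists>\<epsilon>>0. \<forall>z. norm z \<le> \<epsilon> \<longrightarrow>
       \<bar>\<phi> (x + z) - \<phi> x - grad \<phi> x \<bullet> z - 1/2 * ((hess \<phi> x *v z) \<bullet> z)\<bar> \<le> \<delta> * (norm z)\<^sup>2"
proof -
  let ?p = "grad \<phi> x" and ?X = "hess \<phi> x"
  obtain \<epsilon> where e: "0 < \<epsilon>" "\<And>w. norm w \<le> \<epsilon> \<Longrightarrow>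
      norm (grad \<phi> (x + w) - ?p - ?X *v w) \<le> \<delta> * norm w"
    using C2_grad_approx[OF assms, of x] by auto
  have "\<bar>\<phi> (x + z) - \<phi> x - ?p \<bullet> z - 1/2 * ((?X *v z) \<bullet> z)\<bar> \<le> \<delta> * (norm z)\<^sup>2"
    if z: "norm z \<le> \<epsilon>" for z
  proof -
    define f where "f t = \<phi> (x + t *\<^sub>R z) - t * (?p \<bullet> z) - t\<^sup>2 / 2 * ((?X *v z) \<bullet> z)" for t :: real
    define f' where "f' t = grad \<phi> (x + t *\<^sub>R z) \<bullet> z - ?p \<bullet> z - t * ((?X *v z) \<bullet> z)" for t :: real
    have "(f has_field_derivative f' t) (at t)" for t
      unfolding f_def f'_def
      by (auto intro!: derivative_eq_intros C2_GDERIV_line[OF assms(1)])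
    with MVT2[of 0 1 f f'] obtain t where t: "0 < t" "t < 1" "f 1 - f 0 = f' t" by auto
    have eq: "f' t = (grad \<phi> (x + t *\<^sub>R z) - ?p - ?X *v (t *\<^sub>R z)) \<bullet> z"
      unfolding f'_def by (simp add: inner_diff_left matrix_vector_mult_scaleR)
    have tz: "norm (t *\<^sub>R z) \<le> norm z"
      using t by (simp add: mult_left_le_one_le)
    have "\<bar>f' t\<bar> \<le> norm (grad \<phi> (x + t *\<^sub>R z) - ?p - ?X *v (t *\<^sub>R z)) * norm z"
      unfolding eq by (rule Cauchy_Schwarz_ineq2)
    also have "\<dots> \<le> (\<delta> * norm z) * norm z"
    proof (rule mult_right_mono)
      have "norm (grad \<phi> (x + t *\<^sub>R z) - ?p - ?X *v (t *\<^sub>R z)) \<le> \<delta> * norm (t *\<^sub>R z)"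
        using tz z by (intro e(2)) linarith
      also have "\<dots> \<le> \<delta> * norm z" using tz \<open>0 < \<delta>\<close> by simp
      finally show "norm (grad \<phi> (x + t *\<^sub>R z) - ?p - ?X *v (t *\<^sub>R z)) \<le> \<delta> * norm z" .
    qed simp
    finally have "\<bar>f 1 - f 0\<bar> \<le> \<delta> * (norm z)\<^sup>2" using t by (simp add: power2_eq_square mult.assoc)
    then show ?thesis by (simp add: f_def algebra_simps)
  qed
  with e(1) show ?thesis by (intro exI[of _ \<epsilon>]) simp
qed

text \<open>The second difference is symmetric in \<open>h\<close> and \<open>k\<close>, and it equals \<open>\<langle>X k, h\<rangle>\<close> up to an error
  of order \<open>o((|h| + |k|)\<^sup>2)\<close>. This forces the Hessian \<open>X\<close> to be symmetric.\<close>
lemma C2_second_difference: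
  fixes \<phi> :: "real^'n \<Rightarrow> real"
  assumes "C2 \<phi>" "0 < \<delta>"
  shows "\<exists>\<epsilon>>0. \<forall>h k. norm h + norm k \<le> \<epsilon> \<longrightarrow>
       \<bar>\<phi> (x + h + k) - \<phi> (x + h) - \<phi> (x + k) + \<phi> x - (hess \<phi> x *v k) \<bullet> h\<bar>
         \<le> \<delta> * (norm h + norm k)\<^sup>2"
proof -
  let ?p = "grad \<phi> x" and ?X = "hess \<phi> x"
  obtain \<epsilon> where e: "0 < \<epsilon>" "\<And>w. norm w \<le> \<epsilon> \<Longrightarrow>
      norm (grad \<phi> (x + w) - ?p - ?X *v w) \<le> \<delta> / 2 * norm w"
    using C2_grad_approx[OF assms(1) half_gt_zero[OF assms(2)], of x] by auto
  have "\<bar>\<phi> (x + h + k) - \<phi> (x + h) - \<phi> (x + k) + \<phi> x - (?X *v k) \<bullet> h\<bar>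
         \<le> \<delta> * (norm h + norm k)\<^sup>2"
    if hk: "norm h + norm k \<le> \<epsilon>" for h k
  proof -
    let ?s = "norm h + norm k"
    \<comment> \<open>\<open>g 1 - g 0\<close> is the second difference; only one derivative of \<open>\<phi>\<close> is taken here, and the
      second one comes from the expansion of the gradient at \<open>x\<close>.\<close>
    define g where "g t = \<phi> ((x + k) + t *\<^sub>R h) - \<phi> (x + t *\<^sub>R h)" for t :: real
    define g' where "g' t = grad \<phi> ((x + k) + t *\<^sub>R h) \<bullet> h - grad \<phi> (x + t *\<^sub>R h) \<bullet> h" for t :: real
    have "(g has_field_derivative g' t) (at t)" for t
      unfolding g_def g'_def
      by (auto intro!: derivative_eq_intros C2_GDERIV_line[OF assms(1)])
    with MVT2[of 0 1 g g'] obtain t where t: "0 < t" "t < 1" "g 1 - g 0 = g' t" by auto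
    let ?a = "grad \<phi> (x + (k + t *\<^sub>R h)) - ?p - ?X *v (k + t *\<^sub>R h)"
    let ?b = "grad \<phi> (x + t *\<^sub>R h) - ?p - ?X *v (t *\<^sub>R h)"
    have eq: "g' t - (?X *v k) \<bullet> h = (?a - ?b) \<bullet> h"
      unfolding g'_def
      by (simp add: inner_diff_left inner_add_left matrix_vector_right_distrib add.assoc)
    have th: "norm (t *\<^sub>R h) \<le> norm h"
      using t by (simp add: mult_left_le_one_le)
    have n1: "norm (k + t *\<^sub>R h) \<le> ?s" using norm_triangle_ineq[of k "t *\<^sub>R h"] th by linarith
    have n2: "norm (t *\<^sub>R h) \<le> ?s" using th norm_ge_zero[of k] by linarith
    have "norm ?a \<le> \<delta> / 2 * norm (k + t *\<^sub>R h)" using n1 hk by (intro e(2)) linarith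
    also have "\<dots> \<le> \<delta> / 2 * ?s" using n1 \<open>0 < \<delta>\<close> by (intro mult_left_mono) auto
    finally have a: "norm ?a \<le> \<delta> / 2 * ?s" .
    have "norm ?b \<le> \<delta> / 2 * norm (t *\<^sub>R h)" using n2 hk by (intro e(2)) linarith
    also have "\<dots> \<le> \<delta> / 2 * ?s" using n2 \<open>0 < \<delta>\<close> by (intro mult_left_mono) auto
    finally have b: "norm ?b \<le> \<delta> / 2 * ?s" .
    have "\<bar>(?a - ?b) \<bullet> h\<bar> \<le> norm (?a - ?b) * norm h" by (rule Cauchy_Schwarz_ineq2)
    also have "\<dots> \<le> (\<delta> * ?s) * ?s"
      using a b norm_triangle_ineq4[of ?a ?b] \<open>0 < \<delta>\<close> by (intro mult_mono) auto
    finally have "\<bar>g 1 - g 0 - (?X *v k) \<bullet> h\<bar> \<le> \<delta> * ?s\<^sup>2"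
      using t eq by (simp add: power2_eq_square mult.assoc)
    moreover have "g 1 - g 0 = \<phi> (x + h + k) - \<phi> (x + h) - \<phi> (x + k) + \<phi> x"
      by (simp add: g_def add_ac)
    ultimately show ?thesis by simp
  qed
  with e(1) show ?thesis by (intro exI[of _ \<epsilon>]) simp
qed

lemma C2_hess_sym:
  fixes \<phi> :: "real^'n \<Rightarrow> real"
  assumes "C2 \<phi>"
  shows "sym_mat (hess \<phi> x)"
proof -
  let ?X = "hess \<phi> x"
  have sym: "(?X *v k) \<bullet> h = (?X *v h) \<bullet> k" for h k
  proof -
    let ?s = "norm h + norm k"
    have small: "\<bar>(?X *v k) \<bullet> h - (?X *v h) \<bullet> k\<bar> \<le> \<delta> * (2 * ?s\<^sup>2)" if pos: "0 < \<delta>" for \<delta>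
    proof -
      obtain \<epsilon> where e: "0 < \<epsilon>" "\<And>h k. norm h + norm k \<le> \<epsilon> \<Longrightarrow>
          \<bar>\<phi> (x + h + k) - \<phi> (x + h) - \<phi> (x + k) + \<phi> x - (?X *v k) \<bullet> h\<bar>
            \<le> \<delta> * (norm h + norm k)\<^sup>2"
        using C2_second_difference[OF assms pos, of x] by auto
      \<comment> \<open>Scaling \<open>h\<close> and \<open>k\<close> by \<open>t\<close> gives \<open>|h| + |k| \<le> \<epsilon>\<close>; both sides scale by \<open>t\<^sup>2\<close>.\<close>
      define t where "t = \<epsilon> / (?s + 1)"
      have s1: "0 < ?s + 1" by (intro add_nonneg_pos add_nonneg_nonneg norm_ge_zero zero_less_one)
      have t: "0 < t" using e(1) s1 unfolding t_def by (rule divide_pos_pos)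
      have "t * ?s \<le> t * (?s + 1)" using t by simp
      also have "\<dots> = \<epsilon>" unfolding t_def
        using s1 by simp
      finally have le: "norm (t *\<^sub>R h) + norm (t *\<^sub>R k) \<le> \<epsilon>"
        using t by (simp add: algebra_simps)
      have sq: "(norm (t *\<^sub>R h) + norm (t *\<^sub>R k))\<^sup>2 = t\<^sup>2 * ?s\<^sup>2"
        using t by (simp add: power_mult_distrib[symmetric] distrib_left)
      have l2: "norm (t *\<^sub>R k) + norm (t *\<^sub>R h) \<le> \<epsilon>" using le by simp
      have "x + t *\<^sub>R k + t *\<^sub>R h = x + t *\<^sub>R h + t *\<^sub>R k" by simp
      with e(2)[OF le] e(2)[OF l2] sq
      have "\<bar>(?X *v (t *\<^sub>R k)) \<bullet> (t *\<^sub>R h) - (?X *v (t *\<^sub>R h)) \<bullet> (t *\<^sub>R k)\<bar> \<le> 2 * (\<delta> * (t\<^sup>2 * ?s\<^sup>2))"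
        by (smt (verit) add.commute)
      also have "(?X *v (t *\<^sub>R k)) \<bullet> (t *\<^sub>R h) - (?X *v (t *\<^sub>R h)) \<bullet> (t *\<^sub>R k)
          = t\<^sup>2 * ((?X *v k) \<bullet> h - (?X *v h) \<bullet> k)"
        by (simp add: matrix_vector_mult_scaleR power2_eq_square algebra_simps)
      finally have "t\<^sup>2 * \<bar>(?X *v k) \<bullet> h - (?X *v h) \<bullet> k\<bar> \<le> t\<^sup>2 * (\<delta> * (2 * ?s\<^sup>2))"
        unfolding abs_mult abs_power2 by (simp add: mult_ac)
      then show ?thesis using t by simp
    qed
    have "\<bar>(?X *v k) \<bullet> h - (?X *v h) \<bullet> k\<bar> \<le> 0"
    proof (rule field_le_epsilon)
      fix e :: real assume "0 < e"
      define d where "d = e / (2 * ?s\<^sup>2 + 1)"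
      have pos: "0 < 2 * ?s\<^sup>2 + 1" by (simp add: add_nonneg_pos)
      have d: "0 < d" unfolding d_def using \<open>0 < e\<close> pos by simp
      have "d * (2 * ?s\<^sup>2) \<le> d * (2 * ?s\<^sup>2 + 1)" using d by simp
      also have "\<dots> = e" unfolding d_def using pos by simp
      finally show "\<bar>(?X *v k) \<bullet> h - (?X *v h) \<bullet> k\<bar> \<le> 0 + e" using small[OF d] by linarith
    qed
    then show ?thesis by simp
  qed
  have "transpose ?X *v h = ?X *v h" for h
  proof -
    have "(transpose ?X *v h) \<bullet> k = (?X *v h) \<bullet> k" for k
      using sym[of k h] dot_lmul_matrix[of h ?X k] by (simp add: inner_commute)
    then show ?thesis by (metis vector_eq_ldot inner_commute)
  qed
  then show ?thesis unfolding sym_mat_def by (simp add: matrix_eq)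
qed

section \<open>Test functions with a prescribed jet\<close>

lemma DERIV_positive_part_power:
  "((\<lambda>t::real. max 0 t ^ Suc (Suc k)) has_field_derivative real (Suc (Suc k)) * max 0 t ^ Suc k) (at t)"
proof (cases t "0 :: real" rule: linorder_cases)
  case less
  have "((\<lambda>t::real. 0) has_field_derivative 0) (at t)" by simp
  then have "((\<lambda>t::real. max 0 t ^ Suc (Suc k)) has_field_derivative 0) (at t)"
    by (rule has_field_derivative_transform_within_open[where S = "{..<0}"]) (use less in auto)
  then show ?thesis using less by simp
next
  case equal
  have "((\<lambda>h::real. max 0 h ^ Suc (Suc k) / h) \<longlongrightarrow> 0) (at 0)"
  proof (rule tendsto_0_le[where K = 1])
    show "((\<lambda>h::real. h ^ Suc k) \<longlongrightarrow> 0) (at 0)"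
      using tendsto_power[OF tendsto_ident_at, of "Suc k" "0::real" UNIV] by simp
    show "\<forall>\<^sub>F h::real in at 0. norm (max 0 h ^ Suc (Suc k) / h) \<le> norm (h ^ Suc k) * 1"
      by (intro always_eventually) (auto simp: max_def)
  qed
  then show ?thesis using equal by (simp add: DERIV_def)
next
  case greater
  have "((\<lambda>t::real. t ^ Suc (Suc k)) has_field_derivative real (Suc (Suc k)) * t ^ Suc k) (at t)"
    using DERIV_pow[of "Suc (Suc k)" t] by (simp only: diff_Suc_Suc diff_zero)
  then have "((\<lambda>t::real. max 0 t ^ Suc (Suc k)) has_field_derivative real (Suc (Suc k)) * t ^ Suc k) (at t)"
    by (rule has_field_derivative_transform_within_open[where S = "{0<..}"]) (use greater in auto)
  then show ?thesis using greater by simp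
qed

text \<open>The sum \<open>\<Sum>n. c n * max 0 (s - (n + 1) r) ^ j\<close>. For \<open>j > 0\<close> it is locally finite and vanishes for
  \<open>s \<le> r\<close>, and the coefficients \<open>c n\<close> can be chosen to make it grow arbitrarily fast.\<close>
definition spline :: "real \<Rightarrow> (nat \<Rightarrow> real) \<Rightarrow> nat \<Rightarrow> real \<Rightarrow> real" where
  "spline r c j s = (\<Sum>n. c n * max 0 (s - real (Suc n) * r) ^ j)"

lemma spline_eq_sum:
  assumes "0 < r" "0 < j" "s < real K * r"
  shows "spline r c j s = (\<Sum>n<K. c n * max 0 (s - real (Suc n) * r) ^ j)"
  unfolding spline_def
proof (rule suminf_finite)
  fix n assume "n \<notin> {..<K}"
  then have "real K * r \<le> real (Suc n) * r" using assms(1) by (intro mult_right_mono) auto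
  with assms(3) have "max 0 (s - real (Suc n) * r) = 0" by simp
  then show "c n * max 0 (s - real (Suc n) * r) ^ j = 0" using assms(2) by (simp only: zero_power mult_zero_right)
qed simp

lemma DERIV_spline:
  assumes r: "0 < r"
  shows "(spline r c (Suc (Suc k)) has_field_derivative real (Suc (Suc k)) * spline r c (Suc k) s) (at s)"
proof -
  obtain K :: nat where K: "s < real K * r" using reals_Archimedean3[OF r] by blast
  have shift: "((\<lambda>s. max 0 (s - a) ^ Suc (Suc k)) has_field_derivative
      real (Suc (Suc k)) * max 0 (s - a) ^ Suc k) (at s)" for a :: real
  proof -
    have "((\<lambda>s. s - a) has_field_derivative 1 - 0) (at s)"
      by (intro DERIV_diff DERIV_ident DERIV_const)
    from DERIV_chain2[OF DERIV_positive_part_power[of k "s - a"] this] show ?thesis by simp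
  qed
  have "((\<lambda>s. \<Sum>n<K. c n * max 0 (s - real (Suc n) * r) ^ Suc (Suc k)) has_field_derivative
      (\<Sum>n<K. c n * (real (Suc (Suc k)) * max 0 (s - real (Suc n) * r) ^ Suc k))) (at s)"
    by (intro DERIV_sum DERIV_cmult shift)
  moreover have "(\<Sum>n<K. c n * (real (Suc (Suc k)) * max 0 (s - real (Suc n) * r) ^ Suc k))
      = real (Suc (Suc k)) * spline r c (Suc k) s"
    unfolding spline_eq_sum[OF r zero_less_Suc K] sum_distrib_left
    by (intro sum.cong refl) (simp only: mult.left_commute)
  ultimately have "((\<lambda>s. \<Sum>n<K. c n * max 0 (s - real (Suc n) * r) ^ Suc (Suc k)) has_field_derivative
      real (Suc (Suc k)) * spline r c (Suc k) s) (at s)" by (simp only:)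
  then show ?thesis
    by (rule has_field_derivative_transform_within_open[where S = "{..<real K * r}"])
      (use K spline_eq_sum[OF r] in auto)
qed

lemma continuous_spline:
  assumes r: "0 < r"
  shows "continuous_on UNIV (spline r c (Suc k))"
proof -
  have "isCont (spline r c (Suc k)) s" for s
  proof -
    obtain K :: nat where K: "s < real K * r" using reals_Archimedean3[OF r] by blast
    have "continuous_on {..<real K * r} (\<lambda>s. \<Sum>n<K. c n * max 0 (s - real (Suc n) * r) ^ Suc k)"
      by (intro continuous_intros)
    then have "continuous_on {..<real K * r} (spline r c (Suc k))"
      by (rule continuous_on_eq) (simp only: lessThan_iff spline_eq_sum[OF r zero_less_Suc])
    with K show ?thesis by (simp add: continuous_on_eq_continuous_at)
  qed
  then show ?thesis by (simp add: continuous_at_imp_continuous_on)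
qed

lemma spline_eq_0:
  assumes "0 < r" "s \<le> r" "0 < j"
  shows "spline r c j s = 0"
proof -
  have "s < real 2 * r" using assms by simp
  from spline_eq_sum[OF assms(1,3) this] assms show ?thesis
    by (simp add: numeral_2_eq_2 zero_power)
qed

lemma spline_ge:
  assumes r: "0 < r" and c: "\<And>n. 0 \<le> c n" and j: "0 < j" and s: "real (n + 2) * r \<le> s"
  shows "c n * r ^ j \<le> spline r c j s"
proof -
  obtain K :: nat where K: "s < real K * r" using reals_Archimedean3[OF r] by blast
  have "real (n + 2) * r < real K * r" using s K by linarith
  then have "n < K" using r by simp
  have "c n * r ^ j \<le> c n * max 0 (s - real (Suc n) * r) ^ j"
    using s r c by (intro mult_left_mono power_mono) (auto simp: algebra_simps)
  also have "\<dots> \<le> (\<Sum>n<K. c n * max 0 (s - real (Suc n) * r) ^ j)"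
    using \<open>n < K\<close> c by (intro member_le_sum) auto
  also have "\<dots> = spline r c j s" by (rule spline_eq_sum[OF r j K, symmetric])
  finally show ?thesis .
qed

lemma spline_nonneg:
  assumes r: "0 < r" and c: "\<And>n. 0 \<le> c n" and j: "0 < j"
  shows "0 \<le> spline r c j s"
proof -
  obtain K :: nat where K: "s < real K * r" using reals_Archimedean3[OF r] by blast
  show ?thesis unfolding spline_eq_sum[OF r j K] using c by (intro sum_nonneg mult_nonneg_nonneg) auto
qed

text \<open>The rank-one matrix \<open>w w\<^sup>T\<close>.\<close>
definition outer :: "real^'n \<Rightarrow> real^'n^'n" where
  "outer w = (\<chi> i j. w $ i * w $ j)"

lemma outer_mult: "outer w *v h = (w \<bullet> h) *\<^sub>R w"
  by (simp add: outer_def vec_eq_iff matrix_vector_mult_def inner_vec_def sum_distrib_left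
      sum_distrib_right mult_ac)

lemma sym_mat_inner: "sym_mat X \<Longrightarrow> a \<bullet> (X *v b) = b \<bullet> (X *v a)"
  by (metis dot_lmul_matrix inner_commute sym_mat_def vector_transpose_matrix)

lemma sym_mat_shift: "sym_mat X \<Longrightarrow> sym_mat (X + a *\<^sub>R mat 1)"
  by (simp add: sym_mat_def transpose_def vec_eq_iff mat_def)

lemma quadratic_form_shift:
  "1/2 * (((X + (2 * \<delta>) *\<^sub>R mat 1) *v z) \<bullet> z) = 1/2 * ((X *v z) \<bullet> z) + \<delta> * (norm z)\<^sup>2"
  for X :: "real^'n^'n"
  by (simp add: matrix_vector_mult_add_rdistrib scaleR_matrix_vector_assoc[symmetric]
      inner_add_left power2_norm_eq_inner)

lemma C2_quadratic_plus_radial: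
  fixes x p :: "real^'n" and Y :: "real^'n^'n" and a :: real
  assumes Y: "sym_mat Y"
    and \<psi>: "\<And>s. (\<psi> has_field_derivative \<psi>1 s) (at s)"
    and \<psi>1: "\<And>s. (\<psi>1 has_field_derivative \<psi>2 s) (at s)"
    and \<psi>2: "continuous_on UNIV \<psi>2"
  defines "\<phi> \<equiv> \<lambda>y. a + p \<bullet> (y - x) + 1/2 * ((Y *v (y - x)) \<bullet> (y - x)) + \<psi> ((y - x) \<bullet> (y - x))"
  shows "C2 \<phi>" and "grad \<phi> x = p" and "hess \<phi> x = Y + (2 * \<psi>1 0) *\<^sub>R mat 1"
proof -
  define G where "G y = p + Y *v (y - x) + (2 * \<psi>1 ((y - x) \<bullet> (y - x))) *\<^sub>R (y - x)" for y
  define H where "H y = Y + (2 * \<psi>1 ((y - x) \<bullet> (y - x))) *\<^sub>R mat 1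
    + (4 * \<psi>2 ((y - x) \<bullet> (y - x))) *\<^sub>R outer (y - x)" for y
  have w: "((\<lambda>y. y - x) has_derivative (\<lambda>h. h)) (at y)" for y
    by (auto intro!: derivative_eq_intros)
  have Yw: "((\<lambda>y. Y *v (y - x)) has_derivative (\<lambda>h. Y *v h)) (at y)" for y
    by (rule bounded_linear.has_derivative[OF matrix_vector_mul_bounded_linear w])
  have sq: "((\<lambda>y. (y - x) \<bullet> (y - x)) has_derivative (\<lambda>h. 2 * ((y - x) \<bullet> h))) (at y)" for y
    using has_derivative_inner[OF w[of y] w[of y]] by (simp add: inner_commute)
  have comp: "((\<lambda>y. f ((y - x) \<bullet> (y - x))) has_derivative
      (\<lambda>h. f' ((y - x) \<bullet> (y - x)) * (2 * ((y - x) \<bullet> h)))) (at y)"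
    if "\<And>s. (f has_field_derivative f' s) (at s)" for f f' :: "real \<Rightarrow> real" and y
    by (rule has_derivative_compose[OF sq that[unfolded has_field_derivative_def]])
  have 1: "GDERIV \<phi> y :> G y" for y
    unfolding gderiv_def \<phi>_def
    by (rule has_derivative_eq_rhs, (rule has_derivative_add has_derivative_const
          has_derivative_inner has_derivative_mult_right w Yw comp[OF \<psi>])+)
      (auto simp: G_def inner_add_right inner_commute sym_mat_inner[OF Y] algebra_simps)
  have 2: "(G has_derivative (\<lambda>h. H y *v h)) (at y)" for y
    unfolding G_def
    by (rule has_derivative_eq_rhs, (rule has_derivative_add has_derivative_const
          has_derivative_scaleR has_derivative_mult_right w Yw comp[OF \<psi>1])+)
      (auto simp: H_def matrix_vector_mult_add_rdistrib outer_mult scaleR_matrix_vector_assoc[symmetric])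
  have \<psi>1c: "continuous_on UNIV \<psi>1" by (rule DERIV_continuous_on[OF has_field_derivative_at_within[OF \<psi>1]])
  have "continuous_on UNIV (\<lambda>y. outer (y - x))"
    unfolding outer_def by (intro continuous_intros)
  then have 3: "continuous_on UNIV H"
    unfolding H_def
    by (intro continuous_intros continuous_on_compose2[OF \<psi>1c] continuous_on_compose2[OF \<psi>2]) auto
  note C = C2_intro[where \<phi> = \<phi> and G = G and H = H, OF 1 2 3]
  show "C2 \<phi>" by (rule C(1))
  show "grad \<phi> x = p" using C(2) by (simp add: G_def)
  show "hess \<phi> x = Y + (2 * \<psi>1 0) *\<^sub>R mat 1" using C(3) by (simp add: H_def outer_def vec_eq_iff)
qed

lemma usc_bounded_above_on_compact:
  assumes "usc u" "compact K"
  shows "\<exists>b. \<forall>y\<in>K. u y \<le> b"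
proof -
  have "K \<subseteq> (\<Union>n::nat. {y. u y < real n})"
    using reals_Archimedean2 by auto
  with assms obtain D where D: "finite D" "K \<subseteq> (\<Union>n\<in>D. {y. u y < real n})"
    using compactE_image[of K UNIV "\<lambda>n. {y. u y < real n}"] unfolding usc_def by metis
  have "u y \<le> real (Max D)" if "y \<in> K" for y
  proof -
    obtain n where "n \<in> D" "u y < real n" using D(2) \<open>y \<in> K\<close> by auto
    moreover have "n \<le> Max D" using D(1) \<open>n \<in> D\<close> by simp
    ultimately show ?thesis by linarith
  qed
  then show ?thesis by blast
qed

text \<open>A local touching from above by a quadratic polynomial becomes a global one by a \<open>C\<^sup>2\<close>
  function with the same second-order jet: a radial function is added that vanishes near \<open>x\<close> and
  outgrows \<open>u\<close>, which is bounded above on compact sets.\<close>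
lemma touch_above_imp_test_above:
  fixes u :: "real^'n \<Rightarrow> real"
  assumes u: "usc u" and X: "sym_mat X" and \<epsilon>: "0 < \<epsilon>" and touch: "touch_above u x p X \<epsilon> \<delta>"
  shows "\<exists>\<phi>. test_above u \<phi> x \<and> grad \<phi> x = p \<and> hess \<phi> x = X + (2 * \<delta>) *\<^sub>R mat 1"
proof -
  define Y where "Y = X + (2 * \<delta>) *\<^sub>R mat 1"
  \<comment> \<open>In terms of \<open>s = |y - x|\<^sup>2\<close>, the points outside the ball are those with \<open>s > 2 r\<close>, where the
    spline is already active, while it vanishes for \<open>s \<le> r\<close>.\<close>
  define r where "r = \<epsilon>\<^sup>2 / 2"
  have r: "0 < r" using \<epsilon> by (simp add: r_def)
  have Y: "sym_mat Y" unfolding Y_def by (rule sym_mat_shift[OF X])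
  have Yz: "1/2 * ((Y *v z) \<bullet> z) = 1/2 * ((X *v z) \<bullet> z) + \<delta> * (norm z)\<^sup>2" for z
    unfolding Y_def by (rule quadratic_form_shift)
  define Q where "Q y = u x + p \<bullet> (y - x) + 1/2 * ((Y *v (y - x)) \<bullet> (y - x))" for y
  have "\<exists>M. \<forall>n. \<forall>y. (y - x) \<bullet> (y - x) \<le> real (n + 3) * r \<longrightarrow> u y - Q y \<le> M n"
  proof (intro choice allI)
    fix n :: nat
    define K where "K = cball x (sqrt (real (n + 3) * r))"
    have "compact K" by (simp add: K_def)
    then obtain b where b: "\<forall>y\<in>K. u y \<le> b" using usc_bounded_above_on_compact[OF u] by blast
    have "continuous_on K Q"
      unfolding Q_def
      by (intro continuous_intros bounded_linear.continuous_on[OF matrix_vector_mul_bounded_linear])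
    then have "bounded (Q ` K)"
      using \<open>compact K\<close> compact_continuous_image compact_imp_bounded by blast
    then obtain c where c: "\<forall>y\<in>K. norm (Q y) \<le> c" unfolding bounded_iff by blast
    have "u y - Q y \<le> b + c" if "(y - x) \<bullet> (y - x) \<le> real (n + 3) * r" for y
    proof -
      have "y \<in> K"
        using real_sqrt_le_mono[OF that]
        unfolding K_def mem_cball dist_norm norm_minus_commute[of x y] norm_eq_sqrt_inner[of "y - x"] .
      then have "u y \<le> b" "norm (Q y) \<le> c" using b c by auto
      then show ?thesis by simp
    qed
    then show "\<exists>M. \<forall>y. (y - x) \<bullet> (y - x) \<le> real (n + 3) * r \<longrightarrow> u y - Q y \<le> M" by blast
  qed
  then obtain M where M: "\<And>n y. (y - x) \<bullet> (y - x) \<le> real (n + 3) * r \<Longrightarrow> u y - Q y \<le> M n" by blast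
  \<comment> \<open>By \<open>spline_ge\<close> the cubic spline with these coefficients is at least \<open>M n\<close> for
    \<open>s \<ge> (n + 2) r\<close>.\<close>
  define c where "c n = \<bar>M n\<bar> / r ^ 3" for n
  have c: "0 \<le> c n" for n using r by (simp add: c_def)
  define \<psi> where "\<psi> = spline r c 3"
  define \<psi>1 where "\<psi>1 s = 3 * spline r c 2 s" for s
  define \<psi>2 where "\<psi>2 s = 6 * spline r c 1 s" for s
  have d1: "(\<psi> has_field_derivative \<psi>1 s) (at s)" for s
    using DERIV_spline[OF r, of c 1 s] by (simp add: \<psi>_def \<psi>1_def numeral_3_eq_3 numeral_2_eq_2)
  have d2: "(\<psi>1 has_field_derivative \<psi>2 s) (at s)" for s
    unfolding \<psi>1_def \<psi>2_def
    using DERIV_cmult[OF DERIV_spline[OF r, of c 0 s], of 3] by (simp add: numeral_2_eq_2)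
  have c2: "continuous_on UNIV \<psi>2"
    unfolding \<psi>2_def using continuous_spline[OF r, of c 0] by (intro continuous_intros) simp
  define \<phi> where "\<phi> y = u x + p \<bullet> (y - x) + 1/2 * ((Y *v (y - x)) \<bullet> (y - x)) + \<psi> ((y - x) \<bullet> (y - x))" for y
  note C = C2_quadratic_plus_radial[OF Y d1 d2 c2, where a = "u x" and p = p and x = x, folded \<phi>_def]
  have \<phi>Q: "\<phi> y = Q y + \<psi> ((y - x) \<bullet> (y - x))" for y by (simp add: \<phi>_def Q_def)
  have \<psi>0: "\<psi> 0 = 0" "\<psi>1 0 = 0" using r by (simp_all add: \<psi>_def \<psi>1_def spline_eq_0)
  have \<phi>x: "\<phi> x = u x" by (simp add: \<phi>_def \<psi>0)
  have "u y \<le> \<phi> y" for y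
  proof (cases "norm (y - x) \<le> \<epsilon>")
    case True
    have "u (x + (y - x)) - u x
        \<le> p \<bullet> (y - x) + 1/2 * ((X *v (y - x)) \<bullet> (y - x)) + \<delta> * (norm (y - x))\<^sup>2"
      using touch True unfolding touch_above_def by blast
    then have "u y \<le> Q y" unfolding Q_def Yz by simp
    also have "\<dots> \<le> \<phi> y" unfolding \<phi>Q \<psi>_def using spline_nonneg[OF r c] by simp
    finally show ?thesis .
  next
    case False
    define s where "s = (y - x) \<bullet> (y - x)"
    \<comment> \<open>\<open>n\<close> is chosen with \<open>(n + 2) r \<le> s \<le> (n + 3) r\<close>.\<close>
    define n where "n = nat (\<lfloor>s / r\<rfloor> - 2)"
    have "\<epsilon>\<^sup>2 \<le> (norm (y - x))\<^sup>2" using False \<epsilon> by (intro power_mono) auto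
    then have "2 * r \<le> s" by (simp add: r_def s_def power2_norm_eq_inner)
    then have "2 \<le> s / r" using r by (simp add: pos_le_divide_eq)
    then have "2 \<le> \<lfloor>s / r\<rfloor>" by (simp add: le_floor_iff)
    then have n: "real n = real_of_int \<lfloor>s / r\<rfloor> - 2" by (simp add: n_def)
    have "real (n + 2) \<le> s / r" "s / r \<le> real (n + 3)"
      using n of_int_floor_le[of "s / r"] real_of_int_floor_add_one_ge[of "s / r"] by linarith+
    then have n1: "real (n + 2) * r \<le> s" and n2: "s \<le> real (n + 3) * r"
      using r by (simp_all add: pos_le_divide_eq pos_divide_le_eq)
    have "u y - Q y \<le> M n" using M n2 by (simp add: s_def)
    also have "\<dots> \<le> c n * r ^ 3" using r by (simp add: c_def)
    also have "\<dots> \<le> \<psi> s" unfolding \<psi>_def by (rule spline_ge[OF r c _ n1]) simp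
    finally show ?thesis unfolding \<phi>Q s_def by simp
  qed
  then have "test_above u \<phi> x" unfolding test_above_def using C(1) \<phi>x by simp
  moreover have "grad \<phi> x = p" by (rule C(2))
  moreover have "hess \<phi> x = Y" using C(3) by (simp add: \<psi>0)
  ultimately show ?thesis unfolding Y_def by blast
qed

section \<open>Extended integrals and Levy measures\<close>

lemma ext_integral_set_integrable:
  assumes "set_integrable M A f"
  shows "ext_integral_exists M A f" and "ext_integral M A f = ereal (LINT z:A|M. f z)"
proof -
  have int: "integrable M (\<lambda>z. f z * indicator A z)"
    using assms by (simp add: set_integrable_def mult.commute)
  have eq: "(\<integral>\<^sup>+z\<in>A. ennreal (f z) \<partial>M) = (\<integral>\<^sup>+z. ennreal (f z * indicator A z) \<partial>M)"
    "(\<integral>\<^sup>+z\<in>A. ennreal (- f z) \<partial>M) = (\<integral>\<^sup>+z. ennreal (- (f z * indicator A z)) \<partial>M)"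
    by (simp_all add: nn_integral_set_ennreal)
  have fin: "(\<integral>\<^sup>+z\<in>A. ennreal (f z) \<partial>M) < \<infinity>" "(\<integral>\<^sup>+z\<in>A. ennreal (- f z) \<partial>M) < \<infinity>"
    unfolding eq using integrableD(2,3)[OF int] by (auto simp: top.not_eq_extremum)
  show "ext_integral_exists M A f"
    using assms fin by (simp add: ext_integral_exists_def set_integrable_def set_borel_measurable_def)
  have "(LINT z:A|M. f z) = enn2real (\<integral>\<^sup>+z\<in>A. ennreal (f z) \<partial>M) - enn2real (\<integral>\<^sup>+z\<in>A. ennreal (- f z) \<partial>M)"
    using real_lebesgue_integral_def[OF int] unfolding eq
    by (simp add: set_lebesgue_integral_def mult.commute)
  moreover have "enn2ereal a = ereal (enn2real a)" if "a < \<infinity>" for a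
    using that by (cases a) (auto simp: enn2ereal_ennreal)
  ultimately show "ext_integral M A f = ereal (LINT z:A|M. f z)"
    unfolding ext_integral_def using fin by (metis ereal_minus(1))
qed

lemma ext_integral_mono:
  assumes "\<And>z. z \<in> A \<Longrightarrow> f z \<le> g z"
  shows "ext_integral M A f \<le> ext_integral M A g"
  unfolding ext_integral_def
proof (intro ereal_minus_mono)
  show "enn2ereal (\<integral>\<^sup>+z\<in>A. ennreal (f z) \<partial>M) \<le> enn2ereal (\<integral>\<^sup>+z\<in>A. ennreal (g z) \<partial>M)"
    unfolding less_eq_ennreal.rep_eq[symmetric]
    using assms by (intro nn_integral_mono) (auto simp: ennreal_leI split: split_indicator)
  show "enn2ereal (\<integral>\<^sup>+z\<in>A. ennreal (- g z) \<partial>M) \<le> enn2ereal (\<integral>\<^sup>+z\<in>A. ennreal (- f z) \<partial>M)"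
    unfolding less_eq_ennreal.rep_eq[symmetric]
    using assms by (intro nn_integral_mono) (auto simp: ennreal_leI split: split_indicator)
qed

lemma ext_integral_uminus:
  assumes "ext_integral_exists M A f"
  shows "ext_integral_exists M A (\<lambda>z. - f z)" "ext_integral M A (\<lambda>z. - f z) = - ext_integral M A f"
proof -
  show "ext_integral_exists M A (\<lambda>z. - f z)"
    using assms by (auto simp: ext_integral_exists_def set_borel_measurable_def)
  have swap: "enn2ereal a - enn2ereal b = - (enn2ereal b - enn2ereal a)" if "a < \<infinity> \<or> b < \<infinity>" for a b
    using that by (cases a; cases b) (auto simp: enn2ereal_ennreal)
  show "ext_integral M A (\<lambda>z. - f z) = - ext_integral M A f"
    unfolding ext_integral_def minus_minus
    by (rule swap) (use assms in \<open>auto simp: ext_integral_exists_def\<close>)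
qed

text \<open>If the integral exists and is not \<open>-\<infinity>\<close>, its negative part is finite: were it infinite, the
  positive part would be finite.\<close>
lemma ext_integral_exists_not_minf:
  assumes "ext_integral_exists M A f" "ext_integral M A f \<noteq> -\<infinity>"
  shows "(\<integral>\<^sup>+z\<in>A. ennreal (- f z) \<partial>M) < \<infinity>"
proof (rule ccontr)
  assume "\<not> ?thesis"
  then have inf: "(\<integral>\<^sup>+z\<in>A. ennreal (- f z) \<partial>M) = top"
    by (metis infinity_ennreal_def top.not_eq_extremum)
  with assms(1) have "(\<integral>\<^sup>+z\<in>A. ennreal (f z) \<partial>M) < top" by (simp add: ext_integral_exists_def)
  with inf have "ext_integral M A f = -\<infinity>"
    unfolding ext_integral_def by (cases "\<integral>\<^sup>+z\<in>A. ennreal (f z) \<partial>M") (auto simp: enn2ereal_ennreal)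
  with assms(2) show False by simp
qed

text \<open>An integral over the whole space splits at \<open>B\<close> when the integrand is integrable on \<open>B\<close> and
  its negative part is integrable off \<open>B\<close>.\<close>
lemma ext_integral_split:
  assumes f: "f \<in> borel_measurable M" and B: "B \<in> sets M" "- B \<in> sets M"
    and int: "set_integrable M B f" and neg: "(\<integral>\<^sup>+z\<in>- B. ennreal (- f z) \<partial>M) < \<infinity>"
  shows "ext_integral_exists M UNIV f"
    and "ext_integral M UNIV f = ereal (LINT z:B|M. f z) + ext_integral M (- B) f"
proof -
  have split: "(\<integral>\<^sup>+z\<in>UNIV. g z \<partial>M) = (\<integral>\<^sup>+z\<in>B. g z \<partial>M) + (\<integral>\<^sup>+z\<in>- B. g z \<partial>M)"
    if "g \<in> borel_measurable M" for g :: "'a \<Rightarrow> ennreal"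
    using nn_integral_disjoint_pair[OF that B] by simp
  have P: "(\<integral>\<^sup>+z\<in>UNIV. ennreal (f z) \<partial>M) = (\<integral>\<^sup>+z\<in>B. ennreal (f z) \<partial>M) + (\<integral>\<^sup>+z\<in>- B. ennreal (f z) \<partial>M)"
    and N: "(\<integral>\<^sup>+z\<in>UNIV. ennreal (- f z) \<partial>M) = (\<integral>\<^sup>+z\<in>B. ennreal (- f z) \<partial>M) + (\<integral>\<^sup>+z\<in>- B. ennreal (- f z) \<partial>M)"
    using f by (intro split; measurable)+
  have int': "integrable M (\<lambda>z. f z * indicator B z)"
    using int by (simp add: set_integrable_def mult.commute)
  have fin: "(\<integral>\<^sup>+z\<in>B. ennreal (f z) \<partial>M) < \<infinity>" "(\<integral>\<^sup>+z\<in>B. ennreal (- f z) \<partial>M) < \<infinity>"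
    using integrableD(2,3)[OF int'] by (auto simp: nn_integral_set_ennreal top.not_eq_extremum)
  show "ext_integral_exists M UNIV f"
    unfolding ext_integral_exists_def N using f fin neg by (simp add: set_borel_measurable_def)
  have arith: "enn2ereal (a + b) - enn2ereal (c + d)
      = (enn2ereal a - enn2ereal c) + (enn2ereal b - enn2ereal d)"
    if "a < \<infinity>" "c < \<infinity>" "d < \<infinity>" for a b c d
    using that by (cases a; cases b; cases c; cases d)
      (auto simp: enn2ereal_ennreal plus_ennreal.rep_eq)
  show "ext_integral M UNIV f = ereal (LINT z:B|M. f z) + ext_integral M (- B) f"
    unfolding ext_integral_set_integrable(2)[OF int, symmetric]
    unfolding ext_integral_def P N using fin neg by (intro arith)
qed

lemma levy_measure_sets: "levy_measure q \<Longrightarrow> sets q = sets borel"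
  by (simp add: levy_measure_def)

lemma levy_measure_measurable:
  assumes "levy_measure q" "f \<in> borel_measurable borel"
  shows "f \<in> borel_measurable q"
  using assms measurable_cong_sets[OF levy_measure_sets refl] by blast

text \<open>The total mass of a Levy measure near 0 may be infinite, but functions that are \<open>O(|z|\<^sup>2)\<close> are
  integrable there.\<close>
lemma levy_measure_square_integrable:
  assumes q: "levy_measure q" and "\<epsilon> \<le> 1"
  shows "set_integrable q (ball 0 \<epsilon>) (\<lambda>z. (norm z)\<^sup>2)"
proof -
  have "(\<integral>\<^sup>+z\<in>ball 0 1. ennreal ((norm z)\<^sup>2) \<partial>q) < \<infinity>"
    using q unfolding levy_measure_def by (auto simp: top.not_eq_extremum)
  then have "(\<integral>\<^sup>+z. ennreal (norm ((norm z)\<^sup>2 * indicator (ball 0 1) z)) \<partial>q) < \<infinity>"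
    by (simp add: nn_integral_set_ennreal abs_mult)
  then have "integrable q (\<lambda>z. (norm z)\<^sup>2 * indicator (ball 0 1) z)"
    by (intro integrableI_bounded levy_measure_measurable[OF q] borel_measurable_times
        borel_measurable_indicator) auto
  then have "set_integrable q (ball 0 1) (\<lambda>z. (norm z)\<^sup>2)"
    by (simp add: set_integrable_def mult.commute)
  then show ?thesis
    by (rule set_integrable_subset) (use \<open>\<epsilon> \<le> 1\<close> in \<open>auto simp: levy_measure_sets[OF q]\<close>)
qed

lemma levy_measure_integrable_quadratic_bound:
  assumes q: "levy_measure q" and "\<epsilon> \<le> 1" and f: "f \<in> borel_measurable borel"
    and bound: "\<And>z. z \<in> ball 0 \<epsilon> \<Longrightarrow> \<bar>f z\<bar> \<le> C * (norm z)\<^sup>2"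
  shows "set_integrable q (ball 0 \<epsilon>) f"
proof (rule set_integrable_bound)
  show "set_integrable q (ball 0 \<epsilon>) (\<lambda>z. C * (norm z)\<^sup>2)"
    using levy_measure_square_integrable[OF q \<open>\<epsilon> \<le> 1\<close>] by (rule set_integrable_mult_right)
  show "set_borel_measurable q (ball 0 \<epsilon>) f"
    unfolding set_borel_measurable_def
    using f by (intro levy_measure_measurable[OF q] borel_measurable_scaleR
        borel_measurable_indicator) auto
  show "AE z in q. z \<in> ball 0 \<epsilon> \<longrightarrow> norm (f z) \<le> norm (C * (norm z)\<^sup>2)"
    using bound by (intro always_eventually) force
qed

lemma quadratic_form_bound: "\<bar>(X *v z) \<bullet> z\<bar> \<le> onorm ((*v) X) * (norm z)\<^sup>2"
  for X :: "real^'n^'n"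
proof -
  have "\<bar>(X *v z) \<bullet> z\<bar> \<le> norm (X *v z) * norm z" by (rule Cauchy_Schwarz_ineq2)
  also have "\<dots> \<le> (onorm ((*v) X) * norm z) * norm z"
    by (intro mult_right_mono onorm matrix_vector_mul_bounded_linear) simp
  finally show ?thesis by (simp add: power2_eq_square mult.assoc)
qed

lemma levy_measure_integrable_quadratic_form:
  assumes q: "levy_measure q" and "\<epsilon> \<le> 1"
  shows "set_integrable q (ball 0 \<epsilon>) (\<lambda>z. 1/2 * ((X *v z) \<bullet> z))"
proof (rule levy_measure_integrable_quadratic_bound[OF assms])
  have "continuous_on UNIV (\<lambda>z. 1/2 * ((X *v z) \<bullet> z))"
    by (intro continuous_intros bounded_linear.continuous_on[OF matrix_vector_mul_bounded_linear])
  then show "(\<lambda>z. 1/2 * ((X *v z) \<bullet> z)) \<in> borel_measurable borel"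
    by (rule borel_measurable_continuous_onI)
  show "\<bar>1/2 * ((X *v z) \<bullet> z)\<bar> \<le> onorm ((*v) X) / 2 * (norm z)\<^sup>2" for z
    using quadratic_form_bound[of X z] by (simp add: abs_mult)
qed

section \<open>Subsolutions\<close>

lemma levy_integrand_near:
  "norm z \<le> 1 \<Longrightarrow> levy_integrand w x p z = w (x + z) - w x - p \<bullet> z"
  by (simp add: levy_integrand_def inner_commute)

lemma levy_integrand_measurable:
  fixes w :: "real^'n \<Rightarrow> real"
  assumes "continuous_on UNIV w"
  shows "levy_integrand w x p \<in> borel_measurable borel"
proof -
  have 1: "(\<lambda>z. w (x + z) - w x) \<in> borel_measurable borel"
    and 2: "(\<lambda>z. z \<bullet> p) \<in> borel_measurable borel"
    by (intro borel_measurable_continuous_onI continuous_intros continuous_on_compose2[OF assms] subset_UNIV)+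
  have 3: "(indicator (cball 0 1) :: real^'n \<Rightarrow> real) \<in> borel_measurable borel"
    by (rule borel_measurable_indicator) auto
  show ?thesis
    unfolding levy_integrand_def by (rule borel_measurable_diff[OF 1 borel_measurable_times[OF 3 2]])
qed

text \<open>The radius is at most 1, so that the gradient term of the nonlocal integrand is active on the
  whole ball and cancels the linear part of the Taylor expansion.\<close>
lemma test_above_imp_touch_above:
  assumes "test_above u \<phi> x" "0 < \<delta>"
  shows "\<exists>\<epsilon>>0. \<epsilon> \<le> 1 \<and> touch_above u x (grad \<phi> x) (hess \<phi> x) \<epsilon> \<delta> \<and>
    (\<forall>z. norm z \<le> \<epsilon> \<longrightarrow>
       \<bar>levy_integrand \<phi> x (grad \<phi> x) z - 1/2 * ((hess \<phi> x *v z) \<bullet> z)\<bar> \<le> \<delta> * (norm z)\<^sup>2)"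
proof -
  have C2: "C2 \<phi>" and le: "\<And>y. u y - \<phi> y \<le> u x - \<phi> x"
    using assms(1) by (auto simp: test_above_def)
  obtain e where e: "0 < e" "\<And>z. norm z \<le> e \<Longrightarrow>
      \<bar>\<phi> (x + z) - \<phi> x - grad \<phi> x \<bullet> z - 1/2 * ((hess \<phi> x *v z) \<bullet> z)\<bar> \<le> \<delta> * (norm z)\<^sup>2"
    using C2_taylor[OF C2 assms(2), of x] by auto
  have "touch_above u x (grad \<phi> x) (hess \<phi> x) (min e 1) \<delta>"
    unfolding touch_above_def
  proof (intro allI impI)
    fix z :: "real^'a" assume "norm z \<le> min e 1"
    then have "norm z \<le> e" by simp
    from e(2)[OF this] le[of "x + z"]
    show "u (x + z) - u x \<le> grad \<phi> x \<bullet> z + 1/2 * ((hess \<phi> x *v z) \<bullet> z) + \<delta> * (norm z)\<^sup>2"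
      by linarith
  qed
  with e show ?thesis by (intro exI[of _ "min e 1"]) (simp add: levy_integrand_near)
qed

lemma subsolution_A_D:
  assumes A: "subsolution_A \<Omega> F q u" and x: "x \<in> \<Omega>" and jet: "(p, X) \<in> superjet u x"
    and "0 < \<epsilon>" "\<epsilon> \<le> 1" "0 < \<delta>" "touch_above u x p X \<epsilon> \<delta>"
  shows "ext_integral_exists q (- ball 0 \<epsilon>) (levy_integrand u x p) \<and>
        ereal (F x (u x) p X)
          - ereal (LINT z:ball 0 \<epsilon>|q. 1/2 * (((X + (2 * \<delta>) *\<^sub>R mat 1) *v z) \<bullet> z))
          - ext_integral q (- ball 0 \<epsilon>) (levy_integrand u x p) \<le> 0"
  using bspec[OF bspec[OF conjunct2[OF A[unfolded subsolution_A_def]] x] jet] assms(4-)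
  unfolding prod.case by blast

lemma subsolution_A_imp_B:
  assumes q: "levy_measure q" and A: "subsolution_A \<Omega> F q u"
  shows "subsolution_B \<Omega> F q u"
  unfolding subsolution_B_def
proof (intro conjI ballI allI impI)
  show "usc u" using A by (simp add: subsolution_A_def)
next
  fix x \<phi> assume x: "x \<in> \<Omega>" and \<phi>: "test_above u \<phi> x"
  define p where "p = grad \<phi> x"
  define X where "X = hess \<phi> x"
  define f where "f = levy_integrand \<phi> x p"
  define g where "g = levy_integrand u x p"
  define m where "m = (LINT z:ball 0 1|q. (norm z)\<^sup>2)"
  define E where "E = ext_integral q UNIV f"
  have C2: "C2 \<phi>" using \<phi> by (simp add: test_above_def)
  have gf: "g z \<le> f z" for z
  proof -
    have "u (x + z) - \<phi> (x + z) \<le> u x - \<phi> x" using \<phi> unfolding test_above_def by blast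
    then show ?thesis by (simp add: f_def g_def levy_integrand_def)
  qed
  have f_meas: "f \<in> borel_measurable borel"
    unfolding f_def by (rule levy_integrand_measurable[OF C2_continuous[OF C2]])
  have jet: "(p, X) \<in> superjet u x"
    unfolding superjet_def p_def X_def
    using C2_hess_sym[OF C2] test_above_imp_touch_above[OF \<phi>] by blast
  have key: "ext_integral_exists q UNIV f \<and> ereal (F x (u x) p X) \<le> E + ereal (2 * \<delta> * m)"
    if "0 < \<delta>" for \<delta>
  proof -
    obtain \<epsilon> where \<epsilon>: "0 < \<epsilon>" "\<epsilon> \<le> 1" "touch_above u x p X \<epsilon> \<delta>"
      "\<And>z. norm z \<le> \<epsilon> \<Longrightarrow> \<bar>f z - 1/2 * ((X *v z) \<bullet> z)\<bar> \<le> \<delta> * (norm z)\<^sup>2"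
      using test_above_imp_touch_above[OF \<phi> \<open>0 < \<delta>\<close>] unfolding p_def X_def f_def by auto
    let ?B = "ball 0 \<epsilon> :: (real^'a) set"
    define I where "I = (LINT z:?B|q. 1/2 * (((X + (2 * \<delta>) *\<^sub>R mat 1) *v z) \<bullet> z))"
    have ex: "ext_integral_exists q (- ?B) g"
      and ineq: "ereal (F x (u x) p X) - ereal I - ext_integral q (- ?B) g \<le> 0"
      using subsolution_A_D[OF A x jet \<epsilon>(1,2) \<open>0 < \<delta>\<close> \<epsilon>(3)] unfolding I_def g_def by blast+
    \<comment> \<open>With the value \<open>-\<infinity>\<close> the left-hand side of \<open>ineq\<close> would be \<open>\<infinity>\<close>.\<close>
    have "ext_integral q (- ?B) g \<noteq> -\<infinity>" using ineq by auto
    then have "(\<integral>\<^sup>+z\<in>- ?B. ennreal (- g z) \<partial>q) < \<infinity>"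
      by (rule ext_integral_exists_not_minf[OF ex])
    moreover have "(\<integral>\<^sup>+z\<in>- ?B. ennreal (- f z) \<partial>q) \<le> (\<integral>\<^sup>+z\<in>- ?B. ennreal (- g z) \<partial>q)"
      using gf by (intro nn_integral_mono mult_right_mono ennreal_leI) auto
    ultimately have neg: "(\<integral>\<^sup>+z\<in>- ?B. ennreal (- f z) \<partial>q) < \<infinity>" by (rule le_less_trans[rotated])
    have sq1: "set_integrable q (ball 0 1) (\<lambda>z. (norm z)\<^sup>2)"
      by (rule levy_measure_square_integrable[OF q order_refl])
    have sq: "set_integrable q ?B (\<lambda>z. (norm z)\<^sup>2)"
      by (rule levy_measure_square_integrable[OF q \<epsilon>(2)])
    have f_int: "set_integrable q ?B f"
    proof (rule levy_measure_integrable_quadratic_bound[OF q \<epsilon>(2) f_meas])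
      fix z assume "z \<in> ?B"
      then have "norm z \<le> \<epsilon>" by simp
      from \<epsilon>(4)[OF this] quadratic_form_bound[of X z]
      show "\<bar>f z\<bar> \<le> (onorm ((*v) X) + \<delta>) * (norm z)\<^sup>2"
        unfolding distrib_right by linarith
    qed
    have B: "?B \<in> sets q" "- ?B \<in> sets q" by (simp_all add: levy_measure_sets[OF q])
    note split = ext_integral_split[OF levy_measure_measurable[OF q f_meas] B f_int neg]
    have "I \<le> (LINT z:?B|q. f z + (2 * \<delta>) * (norm z)\<^sup>2)"
      unfolding I_def
    proof (rule set_integral_mono)
      show "set_integrable q ?B (\<lambda>z. 1/2 * (((X + (2 * \<delta>) *\<^sub>R mat 1) *v z) \<bullet> z))"
        by (rule levy_measure_integrable_quadratic_form[OF q \<epsilon>(2)])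
      show "set_integrable q ?B (\<lambda>z. f z + (2 * \<delta>) * (norm z)\<^sup>2)"
        by (intro set_integral_add f_int set_integrable_mult_right sq)
      fix z assume "z \<in> ?B"
      then have "norm z \<le> \<epsilon>" by simp
      from \<epsilon>(4)[OF this]
      show "1/2 * (((X + (2 * \<delta>) *\<^sub>R mat 1) *v z) \<bullet> z) \<le> f z + (2 * \<delta>) * (norm z)\<^sup>2"
        unfolding quadratic_form_shift by linarith
    qed
    also have "\<dots> = (LINT z:?B|q. f z) + 2 * \<delta> * (LINT z:?B|q. (norm z)\<^sup>2)"
      by (subst set_integral_add) (auto intro!: f_int set_integrable_mult_right sq)
    also have "\<dots> \<le> (LINT z:?B|q. f z) + 2 * \<delta> * m"
    proof -
      have "(LINT z:?B|q. (norm z)\<^sup>2) \<le> m"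
        unfolding m_def set_lebesgue_integral_def
        using sq sq1 \<epsilon>(2) unfolding set_integrable_def
        by (intro integral_mono) (auto split: split_indicator)
      then show ?thesis using \<open>0 < \<delta>\<close> by simp
    qed
    finally have I: "I \<le> (LINT z:?B|q. f z) + 2 * \<delta> * m" .
    have "ext_integral q (- ?B) g \<le> ext_integral q (- ?B) f"
      using gf by (rule ext_integral_mono)
    with ineq I have "ereal (F x (u x) p X) \<le> E + ereal (2 * \<delta> * m)"
      unfolding E_def split(2)
      by (cases "ext_integral q (- ?B) g"; cases "ext_integral q (- ?B) f") auto
    with split(1) show ?thesis by blast
  qed
  show "ext_integral_exists q UNIV (levy_integrand \<phi> x (grad \<phi> x))"
    using key[of 1] by (simp add: f_def p_def)
  have m: "0 \<le> m"
    unfolding m_def set_lebesgue_integral_def by (intro integral_nonneg_AE) auto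
  have "ereal (F x (u x) p X) \<le> E"
  proof (rule ereal_le_epsilon2)
    fix e :: real assume e: "0 < e"
    define \<delta> where "\<delta> = e / (2 * (m + 1))"
    have "0 < \<delta>" using e m by (simp add: \<delta>_def)
    have "2 * \<delta> * m \<le> 2 * \<delta> * (m + 1)" using \<open>0 < \<delta>\<close> by simp
    also have "\<dots> = e" using m by (simp add: \<delta>_def field_simps)
    finally have "E + ereal (2 * \<delta> * m) \<le> E + ereal e" by (intro add_left_mono) simp
    with key[OF \<open>0 < \<delta>\<close>] show "ereal (F x (u x) p X) \<le> E + ereal e" by (meson order_trans)
  qed
  then have "ereal (F x (u x) p X) - E \<le> 0" by (cases E) auto
  then show "ereal (F x (u x) (grad \<phi> x) (hess \<phi> x)) - ext_integral q UNIV (levy_integrand \<phi> x (grad \<phi> x)) \<le> 0"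
    unfolding p_def X_def E_def f_def .
qed

lemma continuous_operator_shift:
  fixes X :: "real^'n^'n"
  assumes F: "continuous_operator \<Omega> F" and x: "x \<in> \<Omega>" and X: "sym_mat X"
  shows "((\<lambda>d. F x r p (X + (2 * d) *\<^sub>R mat 1)) \<longlongrightarrow> F x r p X) (at_right 0)"
proof -
  have "((\<lambda>d. X + (2 * d) *\<^sub>R mat 1) \<longlongrightarrow> X + (2 * 0) *\<^sub>R mat 1) (at_right (0::real))"
    by (intro tendsto_intros)
  then have lim: "((\<lambda>d. (x, r, p, X + (2 * d) *\<^sub>R mat 1)) \<longlongrightarrow> (x, r, p, X)) (at_right (0::real))"
    by (intro tendsto_Pair tendsto_const) simp
  have "((\<lambda>d. (\<lambda>(x, r, p, X). F x r p X) (x, r, p, X + (2 * d) *\<^sub>R mat 1))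
      \<longlongrightarrow> (\<lambda>(x, r, p, X). F x r p X) (x, r, p, X)) (at_right 0)"
    by (rule continuous_on_tendsto_compose[OF F[unfolded continuous_operator_def] lim])
      (use x X sym_mat_shift in \<open>auto intro: always_eventually\<close>)
  then show ?thesis by simp
qed

lemma subsolution_C_imp_A:
  fixes u :: "real^'n \<Rightarrow> real"
  assumes F: "continuous_operator \<Omega> F" and q: "levy_measure q" and C: "subsolution_C \<Omega> F q u"
  shows "subsolution_A \<Omega> F q u"
proof -
  have u: "usc u" using C by (simp add: subsolution_C_def)
  have main: "ext_integral_exists q (- ball 0 \<epsilon>) (levy_integrand u x p) \<and>
        ereal (F x (u x) p X)
          - ereal (LINT z:ball 0 \<epsilon>|q. 1/2 * (((X + (2 * \<delta>) *\<^sub>R mat 1) *v z) \<bullet> z))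
          - ext_integral q (- ball 0 \<epsilon>) (levy_integrand u x p) \<le> 0"
    if x: "x \<in> \<Omega>" and jet: "(p, X) \<in> superjet u x" and \<epsilon>: "0 < \<epsilon>" "\<epsilon> \<le> 1"
      and touch: "touch_above u x p X \<epsilon> \<delta>" for x p X \<epsilon> \<delta>
  proof -
    define g where "g = levy_integrand u x p"
    let ?B = "ball 0 \<epsilon> :: (real^'n) set"
    have X: "sym_mat X" using jet by (simp add: superjet_def)
    \<comment> \<open>The test function depends on \<open>d\<close>, but the integrand \<open>g\<close> does not.\<close>
    have shifted: "integrable q g \<and> F x (u x) p (X + (2 * d) *\<^sub>R mat 1) \<le> (LINT z|q. g z)"
      if "0 < d" for d
    proof -
      obtain e where "0 < e" "touch_above u x p X e d"
        using jet \<open>0 < d\<close> by (auto simp: superjet_def)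
      then obtain \<phi> where \<phi>: "test_above u \<phi> x" "grad \<phi> x = p" "hess \<phi> x = X + (2 * d) *\<^sub>R mat 1"
        using touch_above_imp_test_above[OF u X] by blast
      then show ?thesis using C x unfolding subsolution_C_def g_def by fastforce
    qed
    have int: "integrable q g" using shifted[of 1] by simp
    have "F x (u x) p X \<le> (LINT z|q. g z)"
    proof (rule tendsto_upperbound[OF continuous_operator_shift[OF F x X]])
      show "\<forall>\<^sub>F d in at_right 0. F x (u x) p (X + (2 * d) *\<^sub>R mat 1) \<le> (LINT z|q. g z)"
        using shifted by (auto simp: eventually_at_filter)
    qed simp
    have B: "?B \<in> sets q" "- ?B \<in> sets q" by (simp_all add: levy_measure_sets[OF q])
    have int_B: "set_integrable q ?B g" "set_integrable q (- ?B) g"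
      unfolding set_integrable_def using B int by (intro integrable_mult_indicator; simp)+
    have "(LINT z|q. g z) = (LINT z:?B|q. g z) + (LINT z:- ?B|q. g z)"
      using set_integral_Un[OF _ int_B] by (simp add: set_lebesgue_integral_def)
    moreover have "(LINT z:?B|q. g z) \<le> (LINT z:?B|q. 1/2 * (((X + (2 * \<delta>) *\<^sub>R mat 1) *v z) \<bullet> z))"
    proof (rule set_integral_mono[OF int_B(1) levy_measure_integrable_quadratic_form[OF q \<epsilon>(2)]])
      fix z assume "z \<in> ?B"
      then have z: "norm z \<le> \<epsilon>" "norm z \<le> 1" using \<epsilon>(2) by auto
      have "u (x + z) - u x \<le> p \<bullet> z + 1/2 * ((X *v z) \<bullet> z) + \<delta> * (norm z)\<^sup>2"
        using touch z(1) by (simp add: touch_above_def)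
      then show "g z \<le> 1/2 * (((X + (2 * \<delta>) *\<^sub>R mat 1) *v z) \<bullet> z)"
        unfolding g_def levy_integrand_near[OF z(2)] quadratic_form_shift by linarith
    qed
    ultimately have "F x (u x) p X - (LINT z:?B|q. 1/2 * (((X + (2 * \<delta>) *\<^sub>R mat 1) *v z) \<bullet> z))
        - (LINT z:- ?B|q. g z) \<le> 0"
      using \<open>F x (u x) p X \<le> (LINT z|q. g z)\<close> by linarith
    then show ?thesis
      using ext_integral_set_integrable[OF int_B(2)] by (simp add: g_def)
  qed
  show ?thesis unfolding subsolution_A_def using u main by blast
qed

section \<open>Supersolutions by duality\<close>

text \<open>The operator of the equation satisfied by \<open>- v\<close> when \<open>v\<close> satisfies the one with \<open>F\<close>; the nonlocal
  term is odd in the unknown and keeps its form.\<close>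
definition dual_operator ::
  "(real^'n \<Rightarrow> real \<Rightarrow> real^'n \<Rightarrow> real^'n^'n \<Rightarrow> real) \<Rightarrow>
   (real^'n \<Rightarrow> real \<Rightarrow> real^'n \<Rightarrow> real^'n^'n \<Rightarrow> real)" where
  "dual_operator F x r p X = - F x (- r) (- p) (- X)"

lemma sym_mat_uminus: "sym_mat (- X) \<longleftrightarrow> sym_mat X" for X :: "real^'n^'n"
  by (simp add: sym_mat_def transpose_def vec_eq_iff)

lemma continuous_operator_dual:
  fixes F :: "real^'n \<Rightarrow> real \<Rightarrow> real^'n \<Rightarrow> real^'n^'n \<Rightarrow> real"
  assumes "continuous_operator \<Omega> F"
  shows "continuous_operator \<Omega> (dual_operator F)"
proof -
  let ?S = "\<Omega> \<times> UNIV \<times> UNIV \<times> {X. sym_mat X} :: ((real^'n) \<times> real \<times> (real^'n) \<times> (real^'n^'n)) set"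
  have "continuous_on ?S (\<lambda>y. - (\<lambda>(x, r, p, X). F x r p X)
      (fst y, - fst (snd y), - fst (snd (snd y)), - snd (snd (snd y))))"
    by (intro continuous_intros continuous_on_compose2[OF assms[unfolded continuous_operator_def]])
      (auto simp: sym_mat_uminus)
  then show ?thesis
    unfolding continuous_operator_def dual_operator_def by (simp add: case_prod_unfold)
qed

lemma usc_uminus_iff: "usc (\<lambda>x. - v x) \<longleftrightarrow> lsc v"
proof -
  have "{x. - v x < c} = {x. - c < v x}" for c by auto
  then show ?thesis unfolding usc_def lsc_def by (metis minus_minus)
qed

lemma touch_above_uminus: "touch_above (\<lambda>x. - v x) x p X \<epsilon> \<delta> \<longleftrightarrow> touch_below v x (- p) (- X) \<epsilon> \<delta>"
  unfolding touch_above_def touch_below_def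
  by (intro all_cong1 imp_cong refl) (auto simp: minus_matrix_vector_mult)

lemma superjet_uminus: "(p, X) \<in> superjet (\<lambda>x. - v x) x \<longleftrightarrow> (- p, - X) \<in> subjet v x"
  by (simp add: superjet_def subjet_def touch_above_uminus sym_mat_uminus)

lemma levy_integrand_uminus:
  "levy_integrand (\<lambda>x. - w x) x p = (\<lambda>z. - levy_integrand w x (- p) z)"
  by (simp add: levy_integrand_def fun_eq_iff)

lemma ext_integral_exists_uminus_iff:
  "ext_integral_exists M A (\<lambda>z. - f z) \<longleftrightarrow> ext_integral_exists M A f"
  using ext_integral_uminus(1)[of M A f] ext_integral_uminus(1)[of M A "\<lambda>z. - f z"] by auto

lemma ereal_dual_inequality:
  fixes E :: ereal
  shows "ereal (- a) - ereal (- b) - (- E) \<le> 0 \<longleftrightarrow> ereal a - ereal b - E \<ge> 0"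
  by (cases E) auto

lemma supersolution_A_iff_dual:
  fixes v :: "real^'n \<Rightarrow> real"
  shows "supersolution_A \<Omega> F q v \<longleftrightarrow> subsolution_A \<Omega> (dual_operator F) q (\<lambda>x. - v x)"
proof -
  have quad: "(LINT z:ball 0 \<epsilon>|q. 1/2 * (((- X + (2 * \<delta>) *\<^sub>R mat 1) *v z) \<bullet> z))
      = - (LINT z:ball 0 \<epsilon>|q. 1/2 * (((X - (2 * \<delta>) *\<^sub>R mat 1) *v z) \<bullet> z))"
    for X :: "real^'n^'n" and \<epsilon> \<delta>
  proof -
    have "- X + (2 * \<delta>) *\<^sub>R mat 1 = - (X - (2 * \<delta>) *\<^sub>R mat 1)" by simp
    then show ?thesis
      by (simp only: minus_matrix_vector_mult inner_minus_left mult_minus_right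
          set_lebesgue_integral_def scaleR_minus_right Bochner_Integration.integral_minus)
  qed
  have reindex: "(\<forall>(p, X)\<in>superjet (\<lambda>x. - v x) x. P p X) \<longleftrightarrow> (\<forall>(p, X)\<in>subjet v x. P (- p) (- X))"
    for x P
  proof -
    have "P p X" if "\<forall>(p, X)\<in>subjet v x. P (- p) (- X)" "(p, X) \<in> superjet (\<lambda>x. - v x) x" for p X
      using bspec[OF that(1) that(2)[unfolded superjet_uminus]] by simp
    moreover have "P (- p) (- X)" if all: "\<forall>(p, X)\<in>superjet (\<lambda>x. - v x) x. P p X"
      and in_jet: "(p, X) \<in> subjet v x" for p X
    proof -
      have "(- p, - X) \<in> superjet (\<lambda>x. - v x) x"
        unfolding superjet_uminus minus_minus by (rule in_jet)
      from bspec[OF all this] show ?thesis by simp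
    qed
    ultimately show ?thesis by auto
  qed
  have eq: "ext_integral_exists q A (levy_integrand (\<lambda>x. - v x) x (- p)) \<and>
        ereal (dual_operator F x (- v x) (- p) (- X))
          - ereal (LINT z:ball 0 \<epsilon>|q. 1/2 * (((- X + (2 * \<delta>) *\<^sub>R mat 1) *v z) \<bullet> z))
          - ext_integral q A (levy_integrand (\<lambda>x. - v x) x (- p)) \<le> 0 \<longleftrightarrow>
      ext_integral_exists q A (levy_integrand v x p) \<and>
        ereal (F x (v x) p X)
          - ereal (LINT z:ball 0 \<epsilon>|q. 1/2 * (((X - (2 * \<delta>) *\<^sub>R mat 1) *v z) \<bullet> z))
          - ext_integral q A (levy_integrand v x p) \<ge> 0" for A x p X \<epsilon> \<delta>
  proof (cases "ext_integral_exists q A (levy_integrand v x p)")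
    case True
    show ?thesis
      unfolding levy_integrand_uminus ext_integral_exists_uminus_iff quad dual_operator_def minus_minus
        ext_integral_uminus(2)[OF True] ereal_dual_inequality ..
  next
    case False
    then show ?thesis
      unfolding levy_integrand_uminus ext_integral_exists_uminus_iff minus_minus by (simp only: simp_thms)
  qed
  show ?thesis
    unfolding subsolution_A_def supersolution_A_def usc_uminus_iff reindex touch_above_uminus
      minus_minus eq ..
qed

lemma test_above_uminus:
  assumes "test_below v \<phi> x"
  shows "test_above (\<lambda>x. - v x) (\<lambda>x. - \<phi> x) x"
  using assms C2_uminus(1) unfolding test_above_def test_below_def by auto

lemma test_below_uminus:
  assumes "test_above (\<lambda>x. - v x) \<phi> x"
  shows "test_below v (\<lambda>x. - \<phi> x) x"
  unfolding test_below_def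
proof (intro conjI allI)
  have *: "C2 \<phi>" "- v x = \<phi> x" "\<And>y. - v y - \<phi> y \<le> - v x - \<phi> x"
    using assms by (auto simp: test_above_def)
  show "C2 (\<lambda>x. - \<phi> x)" by (rule C2_uminus(1)[OF *(1)])
  show "v x = - \<phi> x" using *(2) by linarith
  show "v x - - \<phi> x \<le> v y - - \<phi> y" for y using *(3)[of y] by linarith
qed

lemma supersolution_B_of_dual:
  fixes v :: "real^'n \<Rightarrow> real"
  assumes "subsolution_B \<Omega> (dual_operator F) q (\<lambda>x. - v x)"
  shows "supersolution_B \<Omega> F q v"
  unfolding supersolution_B_def
proof (intro conjI ballI allI impI)
  show "lsc v" using assms by (simp add: subsolution_B_def usc_uminus_iff)
next
  fix x \<phi> assume x: "x \<in> \<Omega>" and \<phi>: "test_below v \<phi> x"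
  let ?f = "levy_integrand \<phi> x (grad \<phi> x)"
  have C2: "C2 \<phi>" using \<phi> by (simp add: test_below_def)
  have B: "ext_integral_exists q UNIV (\<lambda>z. - ?f z) \<and>
      ereal (dual_operator F x (- v x) (- grad \<phi> x) (- hess \<phi> x)) - ext_integral q UNIV (\<lambda>z. - ?f z) \<le> 0"
    using assms x test_above_uminus[OF \<phi>]
    unfolding subsolution_B_def by (fastforce simp: C2_uminus(2,3)[OF C2] levy_integrand_uminus)
  then show ex: "ext_integral_exists q UNIV ?f" by (simp add: ext_integral_exists_uminus_iff)
  show "ereal (F x (v x) (grad \<phi> x) (hess \<phi> x)) - ext_integral q UNIV ?f \<ge> 0"
    using B ereal_dual_inequality[of _ 0] by (simp add: ext_integral_uminus(2)[OF ex] dual_operator_def)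
qed

lemma subsolution_C_dual:
  fixes v :: "real^'n \<Rightarrow> real"
  assumes "supersolution_C \<Omega> F q v"
  shows "subsolution_C \<Omega> (dual_operator F) q (\<lambda>x. - v x)"
  unfolding subsolution_C_def
proof (intro conjI ballI allI impI)
  show "usc (\<lambda>x. - v x)" using assms by (simp add: supersolution_C_def usc_uminus_iff)
next
  fix x \<phi> assume x: "x \<in> \<Omega>" and \<phi>: "test_above (\<lambda>x. - v x) \<phi> x"
  let ?f = "levy_integrand v x (- grad \<phi> x)"
  have C2: "C2 \<phi>" using \<phi> by (simp add: test_above_def)
  have C: "integrable q ?f \<and> F x (v x) (- grad \<phi> x) (- hess \<phi> x) - (LINT z|q. ?f z) \<ge> 0"
    using assms x test_below_uminus[OF \<phi>]
    unfolding supersolution_C_def by (fastforce simp: C2_uminus(2,3)[OF C2])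
  then show "integrable q (levy_integrand (\<lambda>x. - v x) x (grad \<phi> x))"
    by (simp add: levy_integrand_uminus)
  show "dual_operator F x (- v x) (grad \<phi> x) (hess \<phi> x)
      - (LINT z|q. levy_integrand (\<lambda>x. - v x) x (grad \<phi> x) z) \<le> 0"
    using C by (simp add: levy_integrand_uminus dual_operator_def)
qed

theorem theorem2:
  fixes \<Omega> :: "(real^'n) set"
    and F :: "real^'n \<Rightarrow> real \<Rightarrow> real^'n \<Rightarrow> real^'n^'n \<Rightarrow> real"
    and q :: "(real^'n) measure"
    and u :: "real^'n \<Rightarrow> real"
  assumes "continuous_operator \<Omega> F"
    and "elliptic \<Omega> F"
    and "levy_measure q"
  shows "(subsolution_A \<Omega> F q u \<longrightarrow> subsolution_B \<Omega> F q u) \<and>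
         (supersolution_A \<Omega> F q u \<longrightarrow> supersolution_B \<Omega> F q u) \<and>
         (subsolution_C \<Omega> F q u \<longrightarrow> subsolution_A \<Omega> F q u) \<and>
         (supersolution_C \<Omega> F q u \<longrightarrow> supersolution_A \<Omega> F q u)"
proof (intro conjI impI)
  note F = assms(1) and q = assms(3)
  show "subsolution_A \<Omega> F q u \<Longrightarrow> subsolution_B \<Omega> F q u"
    by (rule subsolution_A_imp_B[OF q])
  show "supersolution_A \<Omega> F q u \<Longrightarrow> supersolution_B \<Omega> F q u"
    unfolding supersolution_A_iff_dual
    by (rule supersolution_B_of_dual[OF subsolution_A_imp_B[OF q]])
  show "subsolution_C \<Omega> F q u \<Longrightarrow> subsolution_A \<Omega> F q u"
    by (rule subsolution_C_imp_A[OF F q])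
  show "supersolution_C \<Omega> F q u \<Longrightarrow> supersolution_A \<Omega> F q u"
    unfolding supersolution_A_iff_dual
    by (rule subsolution_C_imp_A[OF continuous_operator_dual[OF F] q subsolution_C_dual])
qed

end
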